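(* Let $M$ be a smooth $n$-manifold with a fixed smooth inner product (Riemannian metric) $g$ on $TM$. For every Dirac structure $L\subset TM\oplus T^*M$ on $TM$ there is an orthogonal $B\in\mathrm{Aut}(\Gamma(TM))$ such that $L=L_B$, i.e. the module of sections of $L$ is $$L_B=\{((I+B)X,\,(I-B)\omega_X)\;:\;X\in\Gamma(TM)\}.$$
   Context: $\Gamma$ denotes smooth sections. The inner product $g$ identifies $TM$ with $T^*M$: for $X\in\Gamma(TM)$, $\omega_X\in\Gamma(T^*M)$ is the dual form $\omega_X=g(X,\cdot)$. $\mathrm{Aut}(\Gamma(TM))$ is the group of automorphisms of $\Gamma(TM)$ as a module over $C^\infty(M)$, i.e. those induced by vector bundle automorphisms of $TM$ covering the identity of $M$. $B$ is orthogonal if $g(BX,BY)=g(X,Y)$ for all $X,Y$. Via the identification, $B$ acts also on $\Gamma(T^*M)$ by $B\omega_X=\omega_{BX}$. A Dirac structure on $TM$ is a smooth subbundle $L\subset TM\oplus T^*M$ that is maximally isotropic (each fibre is a maximal isotropic subspace) under the pairing $\langle (X,\omega),(Y,\mu)\rangle_+=\frac12(\mu(X)+\omega(Y))$. A subbundle is identified with its module of sections. *)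

theory Defs
  imports "HOL-Analysis.Analysis" "HOL-Library.Function_Algebras"
begin

section \<open>Pointwise real vector space structure on functions\<close>

instantiation "fun" :: (type, scaleR) scaleR
begin

definition scaleR_fun_def: "scaleR a f = (\<lambda>x. a *\<^sub>R f x)"

instance ..

end

instance "fun" :: (type, real_vector) real_vector
  by standard
    (simp_all add: scaleR_fun_def plus_fun_def fun_eq_iff scaleR_add_right scaleR_add_left)


section \<open>Smooth maps between normed spaces\<close>

text \<open>Meant for open \<open>S\<close> and finite-dimensional domain, where all iterated directional
  derivatives existing as Frechet differentiable functions is the usual notion.\<close>

fun Ck_on :: "nat \<Rightarrow> ('a::real_normed_vector \<Rightarrow> 'b::real_normed_vector) \<Rightarrow> 'a set \<Rightarrow> bool" where
  "Ck_on 0 f S \<longleftrightarrow> continuous_on S f"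
| "Ck_on (Suc k) f S \<longleftrightarrow>
     (\<forall>x\<in>S. f differentiable (at x)) \<and>
     (\<forall>v. Ck_on k (\<lambda>x. frechet_derivative f (at x) v) S)"

definition smooth_on :: "('a::real_normed_vector \<Rightarrow> 'b::real_normed_vector) \<Rightarrow> 'a set \<Rightarrow> bool" where
  "smooth_on f S \<longleftrightarrow> (\<forall>k. Ck_on k f S)"


section \<open>Smooth manifolds\<close>

text \<open>A chart is a domain together with a coordinate map; values of the coordinate map outside
  the domain are irrelevant. The model space is an arbitrary \<open>n\<close>-dimensional inner product
  space rather than \<open>real ^ 'n\<close>, so that \<open>n = 0\<close> is not excluded.\<close>

type_synonym ('m, 'e) chart = "'m set \<times> ('m \<Rightarrow> 'e)"

record ('m, 'e) premanifold =
  mtop :: "'m topology"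
  atlas :: "('m, 'e) chart set"

abbreviation points :: "('m, 'e) premanifold \<Rightarrow> 'm set" where
  "points M \<equiv> topspace (mtop M)"

definition chart_inv :: "('m, 'e) chart \<Rightarrow> 'e \<Rightarrow> 'm" where
  "chart_inv c = inv_into (fst c) (snd c)"

definition transition :: "('m, 'e) chart \<Rightarrow> ('m, 'e) chart \<Rightarrow> 'e \<Rightarrow> 'e" where
  "transition c d = snd d \<circ> chart_inv c"

definition is_chart :: "'m topology \<Rightarrow> ('m, 'e::real_inner) chart \<Rightarrow> bool" where
  "is_chart T c \<longleftrightarrow>
     openin T (fst c) \<and> open (snd c ` fst c) \<and>
     homeomorphic_map (subtopology T (fst c)) (top_of_set (snd c ` fst c)) (snd c)"

definition smooth_manifold :: "nat \<Rightarrow> ('m, 'e::real_inner) premanifold \<Rightarrow> bool" where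
  "smooth_manifold n M \<longleftrightarrow>
     (\<exists>B::'e set. finite B \<and> card B = n \<and> independent B \<and> span B = UNIV) \<and>
     Hausdorff_space (mtop M) \<and> second_countable (mtop M) \<and>
     (\<forall>c\<in>atlas M. is_chart (mtop M) c) \<and>
     (\<Union>c\<in>atlas M. fst c) = points M \<and>
     (\<forall>c\<in>atlas M. \<forall>d\<in>atlas M. smooth_on (transition c d) (snd c ` (fst c \<inter> fst d)))"

definition smooth_function ::
    "('m, 'e::real_inner) premanifold \<Rightarrow> 'm set \<Rightarrow> ('m \<Rightarrow> real) \<Rightarrow> bool" where
  "smooth_function M W f \<longleftrightarrow>
     (\<forall>c\<in>atlas M. smooth_on (\<lambda>x. f (chart_inv c x)) (snd c ` (fst c \<inter> W)))"


section \<open>Tangent and cotangent spaces\<close>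

text \<open>A tangent vector at \<open>p\<close> assigns to every chart around \<open>p\<close> a coordinate vector, such that
  these transform by the derivatives of the transition maps. It is \<open>0\<close> on all other charts, to
  make the representation unique. Addition and scaling are pointwise.\<close>

type_synonym ('m, 'e) tvec = "('m, 'e) chart \<Rightarrow> 'e"

definition charts_at :: "('m, 'e) premanifold \<Rightarrow> 'm \<Rightarrow> ('m, 'e) chart set" where
  "charts_at M p = {c \<in> atlas M. p \<in> fst c}"

definition tangent_space ::
    "('m, 'e::real_inner) premanifold \<Rightarrow> 'm \<Rightarrow> ('m, 'e) tvec set" where
  "tangent_space M p =
     {v. (\<forall>c. c \<notin> charts_at M p \<longrightarrow> v c = 0) \<and>
         (\<forall>c\<in>charts_at M p. \<forall>d\<in>charts_at M p.
            v d = frechet_derivative (transition c d) (at (snd c p)) (v c))}"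

text \<open>The dual space; a covector is extended by \<open>0\<close> off the tangent space.\<close>

type_synonym ('m, 'e) covec = "('m, 'e) tvec \<Rightarrow> real"

definition linear_form_on :: "'a::real_vector set \<Rightarrow> ('a \<Rightarrow> real) \<Rightarrow> bool" where
  "linear_form_on V \<omega> \<longleftrightarrow>
     (\<forall>u\<in>V. \<forall>v\<in>V. \<omega> (u + v) = \<omega> u + \<omega> v) \<and> (\<forall>a. \<forall>v\<in>V. \<omega> (a *\<^sub>R v) = a * \<omega> v)"

definition cotangent_space ::
    "('m, 'e::real_inner) premanifold \<Rightarrow> 'm \<Rightarrow> ('m, 'e) covec set" where
  "cotangent_space M p =
     {\<omega>. linear_form_on (tangent_space M p) \<omega> \<and> (\<forall>v. v \<notin> tangent_space M p \<longrightarrow> \<omega> v = 0)}"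

text \<open>The tangent vector at \<open>p\<close> with coordinates \<open>e\<close> in the chart \<open>c\<close>. For fixed \<open>e\<close> this is
  the coordinate vector field in direction \<open>e\<close>.\<close>

definition coord_vec ::
    "('m, 'e::real_inner) premanifold \<Rightarrow> ('m, 'e) chart \<Rightarrow> 'e \<Rightarrow> 'm \<Rightarrow> ('m, 'e) tvec" where
  "coord_vec M c e p = (THE v. v \<in> tangent_space M p \<and> v c = e)"


section \<open>Smooth sections\<close>

definition smooth_vector_field ::
    "('m, 'e::real_inner) premanifold \<Rightarrow> 'm set \<Rightarrow> ('m \<Rightarrow> ('m, 'e) tvec) \<Rightarrow> bool" where
  "smooth_vector_field M W X \<longleftrightarrow>
     (\<forall>p\<in>W. X p \<in> tangent_space M p) \<and>
     (\<forall>c\<in>atlas M. smooth_on (\<lambda>x. X (chart_inv c x) c) (snd c ` (fst c \<inter> W)))"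

definition smooth_covector_field ::
    "('m, 'e::real_inner) premanifold \<Rightarrow> 'm set \<Rightarrow> ('m \<Rightarrow> ('m, 'e) covec) \<Rightarrow> bool" where
  "smooth_covector_field M W \<omega> \<longleftrightarrow>
     (\<forall>p\<in>W. \<omega> p \<in> cotangent_space M p) \<and>
     (\<forall>c\<in>atlas M. \<forall>e. smooth_on
        (\<lambda>x. \<omega> (chart_inv c x) (coord_vec M c e (chart_inv c x))) (snd c ` (fst c \<inter> W)))"

text \<open>Global sections are made extensional by requiring the value \<open>0\<close> at non-points.\<close>

definition vector_fields ::
    "('m, 'e::real_inner) premanifold \<Rightarrow> ('m \<Rightarrow> ('m, 'e) tvec) set" where
  "vector_fields M = {X. smooth_vector_field M (points M) X \<and> (\<forall>p. p \<notin> points M \<longrightarrow> X p = 0)}"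

definition covector_fields ::
    "('m, 'e::real_inner) premanifold \<Rightarrow> ('m \<Rightarrow> ('m, 'e) covec) set" where
  "covector_fields M = {\<omega>. smooth_covector_field M (points M) \<omega> \<and> (\<forall>p. p \<notin> points M \<longrightarrow> \<omega> p = 0)}"


section \<open>Riemannian metrics\<close>

definition riemannian_metric ::
    "('m, 'e::real_inner) premanifold \<Rightarrow> ('m \<Rightarrow> ('m, 'e) tvec \<Rightarrow> ('m, 'e) tvec \<Rightarrow> real) \<Rightarrow> bool" where
  "riemannian_metric M g \<longleftrightarrow>
     (\<forall>p\<in>points M.
        (\<forall>u\<in>tangent_space M p. linear_form_on (tangent_space M p) (g p u)) \<and>
        (\<forall>u\<in>tangent_space M p. \<forall>v\<in>tangent_space M p. g p u v = g p v u) \<and>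
        (\<forall>u\<in>tangent_space M p. u \<noteq> 0 \<longrightarrow> g p u u > 0)) \<and>
     (\<forall>c\<in>atlas M. \<forall>e e'. smooth_on
        (\<lambda>x. g (chart_inv c x) (coord_vec M c e (chart_inv c x)) (coord_vec M c e' (chart_inv c x)))
        (snd c ` fst c))"

definition flat ::
    "('m, 'e::real_inner) premanifold \<Rightarrow> ('m \<Rightarrow> ('m, 'e) tvec \<Rightarrow> ('m, 'e) tvec \<Rightarrow> real) \<Rightarrow>
     ('m \<Rightarrow> ('m, 'e) tvec) \<Rightarrow> 'm \<Rightarrow> ('m, 'e) covec" where
  "flat M g X = (\<lambda>p v. if p \<in> points M \<and> v \<in> tangent_space M p then g p (X p) v else 0)"


section \<open>Automorphisms of the module of vector fields\<close>

definition module_automorphism ::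
    "('m, 'e::real_inner) premanifold \<Rightarrow>
     (('m \<Rightarrow> ('m, 'e) tvec) \<Rightarrow> ('m \<Rightarrow> ('m, 'e) tvec)) \<Rightarrow> bool" where
  "module_automorphism M B \<longleftrightarrow>
     bij_betw B (vector_fields M) (vector_fields M) \<and>
     (\<forall>X\<in>vector_fields M. \<forall>Y\<in>vector_fields M. B (X + Y) = B X + B Y) \<and>
     (\<forall>f. \<forall>X\<in>vector_fields M. smooth_function M (points M) f \<longrightarrow>
        B (\<lambda>p. f p *\<^sub>R X p) = (\<lambda>p. f p *\<^sub>R B X p))"

definition orthogonal_map ::
    "('m, 'e::real_inner) premanifold \<Rightarrow> ('m \<Rightarrow> ('m, 'e) tvec \<Rightarrow> ('m, 'e) tvec \<Rightarrow> real) \<Rightarrow>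
     (('m \<Rightarrow> ('m, 'e) tvec) \<Rightarrow> ('m \<Rightarrow> ('m, 'e) tvec)) \<Rightarrow> bool" where
  "orthogonal_map M g B \<longleftrightarrow>
     (\<forall>X\<in>vector_fields M. \<forall>Y\<in>vector_fields M. \<forall>p\<in>points M.
        g p (B X p) (B Y p) = g p (X p) (Y p))"

text \<open>The action on covector fields transported along \<open>flat\<close>, i.e. \<open>flat X\<close> is sent to
  \<open>flat (B X)\<close>.\<close>

definition covector_action ::
    "('m, 'e::real_inner) premanifold \<Rightarrow> ('m \<Rightarrow> ('m, 'e) tvec \<Rightarrow> ('m, 'e) tvec \<Rightarrow> real) \<Rightarrow>
     (('m \<Rightarrow> ('m, 'e) tvec) \<Rightarrow> ('m \<Rightarrow> ('m, 'e) tvec)) \<Rightarrow>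
     ('m \<Rightarrow> ('m, 'e) covec) \<Rightarrow> 'm \<Rightarrow> ('m, 'e) covec" where
  "covector_action M g B \<omega> = flat M g (B (the_inv_into (vector_fields M) (flat M g) \<omega>))"

definition L_of ::
    "('m, 'e::real_inner) premanifold \<Rightarrow> ('m \<Rightarrow> ('m, 'e) tvec \<Rightarrow> ('m, 'e) tvec \<Rightarrow> real) \<Rightarrow>
     (('m \<Rightarrow> ('m, 'e) tvec) \<Rightarrow> ('m \<Rightarrow> ('m, 'e) tvec)) \<Rightarrow>
     (('m \<Rightarrow> ('m, 'e) tvec) \<times> ('m \<Rightarrow> ('m, 'e) covec)) set" where
  "L_of M g B =
     {(X + B X, flat M g X - covector_action M g B (flat M g X)) | X. X \<in> vector_fields M}"


section \<open>Dirac structures\<close>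

definition pairing :: "('m, 'e) tvec \<times> ('m, 'e) covec \<Rightarrow> ('m, 'e) tvec \<times> ('m, 'e) covec \<Rightarrow> real" where
  "pairing a b = (snd b (fst a) + snd a (fst b)) / 2"

definition isotropic_subspace ::
    "('m, 'e::real_inner) premanifold \<Rightarrow> 'm \<Rightarrow> (('m, 'e) tvec \<times> ('m, 'e) covec) set \<Rightarrow> bool" where
  "isotropic_subspace M p V \<longleftrightarrow>
     subspace V \<and> V \<subseteq> tangent_space M p \<times> cotangent_space M p \<and>
     (\<forall>a\<in>V. \<forall>b\<in>V. pairing a b = 0)"

definition maximal_isotropic ::
    "('m, 'e::real_inner) premanifold \<Rightarrow> 'm \<Rightarrow> (('m, 'e) tvec \<times> ('m, 'e) covec) set \<Rightarrow> bool" where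
  "maximal_isotropic M p V \<longleftrightarrow>
     isotropic_subspace M p V \<and> (\<forall>V'. isotropic_subspace M p V' \<and> V \<subseteq> V' \<longrightarrow> V' = V)"

text \<open>A smooth subbundle of \<open>TM \<oplus> T\<^sup>*M\<close> is given by its fibres, which have constant
  dimension \<open>k\<close> and admit smooth frames locally. Fibres over non-points are irrelevant.\<close>

definition smooth_subbundle ::
    "('m, 'e::real_inner) premanifold \<Rightarrow> ('m \<Rightarrow> (('m, 'e) tvec \<times> ('m, 'e) covec) set) \<Rightarrow> bool" where
  "smooth_subbundle M L \<longleftrightarrow>
     (\<exists>k. \<forall>p\<in>points M. \<exists>W (s :: nat \<Rightarrow> 'm \<Rightarrow> ('m, 'e) tvec \<times> ('m, 'e) covec).
        openin (mtop M) W \<and> p \<in> W \<and>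
        (\<forall>i<k. smooth_vector_field M W (\<lambda>q. fst (s i q)) \<and>
               smooth_covector_field M W (\<lambda>q. snd (s i q))) \<and>
        (\<forall>q\<in>W. inj_on (\<lambda>i. s i q) {..<k} \<and>
                independent ((\<lambda>i. s i q) ` {..<k}) \<and>
                span ((\<lambda>i. s i q) ` {..<k}) = L q))"

definition dirac_structure ::
    "('m, 'e::real_inner) premanifold \<Rightarrow> ('m \<Rightarrow> (('m, 'e) tvec \<times> ('m, 'e) covec) set) \<Rightarrow> bool" where
  "dirac_structure M L \<longleftrightarrow>
     smooth_subbundle M L \<and> (\<forall>p\<in>points M. maximal_isotropic M p (L p))"

definition sections ::
    "('m, 'e::real_inner) premanifold \<Rightarrow> ('m \<Rightarrow> (('m, 'e) tvec \<times> ('m, 'e) covec) set) \<Rightarrow>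
     (('m \<Rightarrow> ('m, 'e) tvec) \<times> ('m \<Rightarrow> ('m, 'e) covec)) set" where
  "sections M L =
     {(X, \<omega>). X \<in> vector_fields M \<and> \<omega> \<in> covector_fields M \<and> (\<forall>p\<in>points M. (X p, \<omega> p) \<in> L p)}"

end

theory Submission
  imports Defs
begin

text \<open>Over a point \<open>p\<close>, write an element of \<open>TM \<oplus> T\<^sup>*M\<close> as \<open>(a + b, \<omega>)\<close> with \<open>\<omega>\<close> dual to \<open>a - b\<close>. In
  terms of \<open>(a, b)\<close> the pairing is \<open>g a a' - g b b'\<close>, so an isotropic fibre is a linear relation
  preserving \<open>g\<close>, that is, a partial isometry, and by maximality it is the graph of an isometry \<open>B\<close> of
  the whole tangent space. A smooth local frame \<open>(u i, w i)\<close> of this graph makes the coefficients of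
  a smooth vector field \<open>X = \<Sum> c i u i\<close> solutions of a linear system with smooth positive definite
  matrix. They are therefore smooth, and so is \<open>B X = \<Sum> c i w i\<close>. Exchanging \<open>u\<close> and \<open>w\<close> gives the
  smooth inverse of \<open>B\<close>.\<close>

section \<open>Smooth maps\<close>

text \<open>The coordinates \<open>(a, b)\<close> are dictated by the formula for
  \<open>L_B\<close>: the pair built from \<open>X\<close> is the one with \<open>a = X\<close> and
  \<open>b = B X\<close>. Hence \<open>B\<close> can be read off each fibre without any choice,
  nothing has to be glued, and linearity over the smooth functions is a fibrewise matter; only
  smoothness calls for local frames. Positive definiteness of \<open>g\<close> turns isotropy into
  injectivity in both directions: if \<open>a = 0\<close> then \<open>g b b = 0\<close>, so
  \<open>b = 0\<close>, and conversely. Totality comes from extension by one vector rather than from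
  computing the rank of \<open>L\<close>: maximality is applied in the form that a null vector
  orthogonal to a fibre lies in the fibre. The linear system for the coefficients consists of normal
  equations. Its matrix is the Gram matrix of the coordinate vectors of the \<open>u i\<close> in
  the fixed inner product of the model space, not in \<open>g\<close>. The same solver, applied to
  the Gram matrix of \<open>g\<close> in a coordinate frame, shows that raising an index preserves
  smoothness; this is what makes the components \<open>a\<close> and \<open>b\<close> of a smooth
  section smooth.\<close>

lemma Ck_on_subset: "Ck_on k f S \<Longrightarrow> T \<subseteq> S \<Longrightarrow> Ck_on k f T"
  by (induction k arbitrary: f) (auto intro: continuous_on_subset)

lemma Ck_on_SucD:
  assumes "Ck_on (Suc k) f S"
  shows "x \<in> S \<Longrightarrow> f differentiable (at x)" "Ck_on k (\<lambda>x. frechet_derivative f (at x) v) S"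
  using assms by simp_all

text \<open>Derivatives of products and inverses contain undifferentiated factors, so the inductions
  below have to lower the order of a factor by one.\<close>

lemma Ck_on_Suc_imp: "Ck_on (Suc k) f S \<Longrightarrow> Ck_on k f S"
proof (induction k arbitrary: f)
  case 0
  then show ?case
    by (auto intro!: continuous_at_imp_continuous_on differentiable_imp_continuous_within)
next
  case (Suc k)
  have "Ck_on k (\<lambda>x. frechet_derivative f (at x) v) S" for v
    by (rule Suc.IH[OF Ck_on_SucD(2)[OF Suc.prems]])
  with Ck_on_SucD(1)[OF Suc.prems] show ?case
    by simp
qed

text \<open>\<open>frechet_derivative\<close> is a choice among all derivatives at \<open>x\<close>.
  Both functions have the same ones, so the choices agree even where there is none.\<close>

lemma frechet_derivative_cong_open:
  assumes "open S" "x \<in> S" "\<And>y. y \<in> S \<Longrightarrow> f y = g y"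
  shows "frechet_derivative f (at x) = frechet_derivative g (at x)"
proof -
  have "(f has_derivative D) (at x) \<longleftrightarrow> (g has_derivative D) (at x)" for D
    using assms has_derivative_transform_within_open[of f D x UNIV S g]
      has_derivative_transform_within_open[of g D x UNIV S f] by auto
  then show ?thesis
    by (simp add: frechet_derivative_def)
qed

lemma Ck_on_cong:
  assumes "open S" "\<And>x. x \<in> S \<Longrightarrow> f x = g x" "Ck_on k f S"
  shows "Ck_on k g S"
  using assms(2,3)
proof (induction k arbitrary: f g)
  case 0
  then show ?case
    using continuous_on_cong[OF refl, of S f g] by simp
next
  case (Suc k)
  have "g differentiable (at x)" if x: "x \<in> S" for x
  proof -
    obtain D where "(f has_derivative D) (at x)"
      using Ck_on_SucD(1)[OF Suc.prems(2) x] unfolding differentiable_def by blast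
    from has_derivative_transform_within_open[of f D x UNIV S g, OF this assms(1) x Suc.prems(1)] show ?thesis
      by (rule differentiableI)
  qed
  moreover have "Ck_on k (\<lambda>x. frechet_derivative g (at x) v) S" for v
  proof (rule Suc.IH[of "\<lambda>x. frechet_derivative f (at x) v"])
    show "frechet_derivative f (at x) v = frechet_derivative g (at x) v" if "x \<in> S" for x
      by (rule fun_cong[OF frechet_derivative_cong_open[of S x f g, OF assms(1) that Suc.prems(1)]])
    show "Ck_on k (\<lambda>x. frechet_derivative f (at x) v) S"
      by (rule Ck_on_SucD(2)[OF Suc.prems(2)])
  qed
  ultimately show ?case
    by simp
qed

text \<open>Derivatives in \<open>Ck_on\<close> are taken at a point, not within the set, so the
  neighbourhoods \<open>N\<close> may leave \<open>S\<close>.\<close>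

lemma Ck_on_local:
  assumes "\<And>x. x \<in> S \<Longrightarrow> \<exists>N. open N \<and> x \<in> N \<and> Ck_on k f N"
  shows "Ck_on k f S"
  using assms
proof (induction k arbitrary: f)
  case 0
  have "isCont f x" if x: "x \<in> S" for x
  proof -
    obtain N where "open N" "x \<in> N" "Ck_on 0 f N"
      using 0[OF x] by blast
    then show ?thesis
      using continuous_on_eq_continuous_at[of N f] by simp
  qed
  then show ?case
    by (simp add: continuous_at_imp_continuous_on)
next
  case (Suc k)
  have "f differentiable (at x)" if x: "x \<in> S" for x
  proof -
    obtain N where "x \<in> N" "Ck_on (Suc k) f N"
      using Suc.prems[OF x] by blast
    then show ?thesis
      by (intro Ck_on_SucD(1))
  qed
  moreover have "Ck_on k (\<lambda>x. frechet_derivative f (at x) v) S" for v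
  proof (rule Suc.IH)
    fix x
    assume "x \<in> S"
    then obtain N where "open N" "x \<in> N" "Ck_on (Suc k) f N"
      using Suc.prems by blast
    then show "\<exists>N. open N \<and> x \<in> N \<and> Ck_on k (\<lambda>x. frechet_derivative f (at x) v) N"
      using Ck_on_SucD(2)[of k f N v] by (intro exI[of _ N]) simp
  qed
  ultimately show ?case
    by simp
qed

text \<open>Replaces the chosen derivative in the definition by an explicit formula
  \<open>D\<close>, as the rules of calculus provide it; on an open set the two may be exchanged
  under further differentiation.\<close>

lemma Ck_on_SucI:
  assumes "open S" "\<And>x. x \<in> S \<Longrightarrow> (f has_derivative D x) (at x)"
    and "\<And>v. Ck_on k (\<lambda>x. D x v) S"
  shows "Ck_on (Suc k) f S"
proof -
  have eq: "frechet_derivative f (at x) = D x" if "x \<in> S" for x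
    using frechet_derivative_at[OF assms(2)[OF that]] by simp
  have "Ck_on k (\<lambda>x. frechet_derivative f (at x) v) S" for v
    by (rule Ck_on_cong[OF assms(1) _ assms(3)[of v]]) (simp add: eq)
  moreover have "f differentiable (at x)" if "x \<in> S" for x
    using assms(2)[OF that] differentiableI by blast
  ultimately show ?thesis
    by simp
qed

lemma Ck_on_Suc_has_derivative:
  "Ck_on (Suc k) f S \<Longrightarrow> x \<in> S \<Longrightarrow> (f has_derivative frechet_derivative f (at x)) (at x)"
  by (simp add: frechet_derivative_works)

lemma Ck_on_const: "open S \<Longrightarrow> Ck_on k (\<lambda>_. a) S"
proof (induction k arbitrary: a)
  case (Suc k)
  show ?case
    by (rule Ck_on_SucI[where D = "\<lambda>_ _. 0"]) (use Suc in auto)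
qed auto

lemma Ck_on_add:
  assumes "open S" "Ck_on k f S" "Ck_on k g S"
  shows "Ck_on k (\<lambda>x. f x + g x) S"
  using assms(2,3)
proof (induction k arbitrary: f g)
  case 0
  then show ?case
    by (auto intro: continuous_on_add)
next
  case (Suc k)
  let ?f' = "\<lambda>x. frechet_derivative f (at x)" and ?g' = "\<lambda>x. frechet_derivative g (at x)"
  have "Ck_on k (\<lambda>x. ?f' x v + ?g' x v) S" for v
    by (rule Suc.IH[OF Suc.prems[THEN Ck_on_SucD(2)]])
  moreover have "((\<lambda>x. f x + g x) has_derivative (\<lambda>v. ?f' x v + ?g' x v)) (at x)" if "x \<in> S" for x
    using Suc.prems[THEN Ck_on_Suc_has_derivative, OF that] by (rule has_derivative_add)
  ultimately show ?case
    using Ck_on_SucI[OF assms(1), of "\<lambda>x. f x + g x" "\<lambda>x v. ?f' x v + ?g' x v" k] by blast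
qed

lemma Ck_on_bounded_linear:
  assumes "open S" "bounded_linear T" "Ck_on k f S"
  shows "Ck_on k (\<lambda>x. T (f x)) S"
  using assms(3)
proof (induction k arbitrary: f)
  case 0
  then show ?case
    using bounded_linear.continuous_on[OF assms(2)] by simp
next
  case (Suc k)
  let ?f' = "\<lambda>x. frechet_derivative f (at x)"
  have "Ck_on k (\<lambda>x. T (?f' x v)) S" for v
    by (rule Suc.IH[OF Suc.prems[THEN Ck_on_SucD(2)]])
  moreover have "((\<lambda>x. T (f x)) has_derivative (\<lambda>v. T (?f' x v))) (at x)" if "x \<in> S" for x
    using Suc.prems[THEN Ck_on_Suc_has_derivative, OF that]
    by (rule bounded_linear.has_derivative[OF assms(2)])
  ultimately show ?case
    using Ck_on_SucI[OF assms(1), of "\<lambda>x. T (f x)" "\<lambda>x v. T (?f' x v)" k] by blast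
qed

lemma Ck_on_bounded_bilinear:
  assumes "open S" "bounded_bilinear T" "Ck_on k f S" "Ck_on k g S"
  shows "Ck_on k (\<lambda>x. T (f x) (g x)) S"
  using assms(3,4)
proof (induction k arbitrary: f g)
  case 0
  then show ?case
    using bounded_bilinear.continuous_on[OF assms(2)] by simp
next
  case (Suc k)
  let ?f' = "\<lambda>x. frechet_derivative f (at x)" and ?g' = "\<lambda>x. frechet_derivative g (at x)"
  have "Ck_on k (\<lambda>x. T (f x) (?g' x v)) S" "Ck_on k (\<lambda>x. T (?f' x v) (g x)) S" for v
    by (rule Suc.IH[OF Suc.prems(1)[THEN Ck_on_Suc_imp] Ck_on_SucD(2)[OF Suc.prems(2)]],
        rule Suc.IH[OF Ck_on_SucD(2)[OF Suc.prems(1)] Suc.prems(2)[THEN Ck_on_Suc_imp]])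
  then have "Ck_on k (\<lambda>x. T (f x) (?g' x v) + T (?f' x v) (g x)) S" for v
    by (rule Ck_on_add[OF assms(1)])
  moreover have "((\<lambda>x. T (f x) (g x)) has_derivative
      (\<lambda>v. T (f x) (?g' x v) + T (?f' x v) (g x))) (at x)" if "x \<in> S" for x
    using Suc.prems[THEN Ck_on_Suc_has_derivative, OF that]
    by (rule bounded_bilinear.FDERIV[OF assms(2)])
  ultimately show ?case
    using Ck_on_SucI[OF assms(1), of "\<lambda>x. T (f x) (g x)" "\<lambda>x v. T (f x) (?g' x v) + T (?f' x v) (g x)" k] by blast
qed

text \<open>The derivative of \<open>inverse f\<close> is a product of \<open>inverse f\<close>,
  known one order lower by induction, and the derivative of \<open>f\<close>.\<close>

lemma Ck_on_inverse:
  fixes f :: "'a::real_normed_vector \<Rightarrow> real"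
  assumes "open S" "\<And>x. x \<in> S \<Longrightarrow> f x \<noteq> 0" "Ck_on k f S"
  shows "Ck_on k (\<lambda>x. inverse (f x)) S"
  using assms(3)
proof (induction k)
  case 0
  then show ?case
    using assms(2) by (auto intro!: Limits.continuous_on_inverse)
next
  case (Suc k)
  have IH: "Ck_on k (\<lambda>x. inverse (f x)) S"
    by (rule Suc.IH[OF Ck_on_Suc_imp[OF Suc.prems]])
  have D: "Ck_on k (\<lambda>x. - (inverse (f x) * frechet_derivative f (at x) v * inverse (f x))) S" for v
  proof -
    have "Ck_on k (\<lambda>x. frechet_derivative f (at x) v) S"
      by (rule Ck_on_SucD(2)[OF Suc.prems])
    note Ck_on_bounded_bilinear[OF assms(1) bounded_bilinear_mult IH this]
    note Ck_on_bounded_bilinear[OF assms(1) bounded_bilinear_mult this IH]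
    from Ck_on_bounded_linear[OF assms(1) bounded_linear_minus[OF bounded_linear_ident] this]
    show ?thesis .
  qed
  have "((\<lambda>x. inverse (f x)) has_derivative
      (\<lambda>v. - (inverse (f x) * frechet_derivative f (at x) v * inverse (f x)))) (at x)" if "x \<in> S" for x
    using Deriv.has_derivative_inverse[of f x, OF assms(2)[OF that]
        Ck_on_Suc_has_derivative[OF Suc.prems that]] .
  from Ck_on_SucI[OF assms(1), of "\<lambda>x. inverse (f x)"
      "\<lambda>x v. - (inverse (f x) * frechet_derivative f (at x) v * inverse (f x))", OF this D]
  show ?case .
qed

lemma smooth_on_subset: "smooth_on f S \<Longrightarrow> T \<subseteq> S \<Longrightarrow> smooth_on f T"
  unfolding smooth_on_def using Ck_on_subset by metis

lemma smooth_on_cong: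
  assumes "open S" "\<And>x. x \<in> S \<Longrightarrow> f x = g x" "smooth_on f S"
  shows "smooth_on g S"
  using assms(3) Ck_on_cong[OF assms(1,2)] by (simp add: smooth_on_def)

lemma smooth_on_local:
  assumes "\<And>x. x \<in> S \<Longrightarrow> \<exists>N. open N \<and> x \<in> N \<and> smooth_on f N"
  shows "smooth_on f S"
  unfolding smooth_on_def
proof (intro allI Ck_on_local)
  show "\<exists>N. open N \<and> x \<in> N \<and> Ck_on k f N" if "x \<in> S" for x k
    using assms[OF that] by (auto simp: smooth_on_def)
qed

lemma smooth_on_const: "open S \<Longrightarrow> smooth_on (\<lambda>_. a) S"
  by (simp add: smooth_on_def Ck_on_const)

lemma smooth_on_add:
  "open S \<Longrightarrow> smooth_on f S \<Longrightarrow> smooth_on g S \<Longrightarrow> smooth_on (\<lambda>x. f x + g x) S"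
  by (simp add: smooth_on_def Ck_on_add)

lemma smooth_on_bounded_linear:
  "open S \<Longrightarrow> bounded_linear T \<Longrightarrow> smooth_on f S \<Longrightarrow> smooth_on (\<lambda>x. T (f x)) S"
  by (simp add: smooth_on_def Ck_on_bounded_linear)

lemma smooth_on_bounded_bilinear:
  "open S \<Longrightarrow> bounded_bilinear T \<Longrightarrow> smooth_on f S \<Longrightarrow> smooth_on g S \<Longrightarrow>
    smooth_on (\<lambda>x. T (f x) (g x)) S"
  by (simp add: smooth_on_def Ck_on_bounded_bilinear)

lemmas smooth_on_mult = smooth_on_bounded_bilinear[OF _ bounded_bilinear_mult]
lemmas smooth_on_scaleR = smooth_on_bounded_bilinear[OF _ bounded_bilinear_scaleR]
lemmas smooth_on_inner = smooth_on_bounded_bilinear[OF _ bounded_bilinear_inner]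
lemmas smooth_on_scaleR_const = smooth_on_bounded_linear[OF _ bounded_linear_scaleR_right]

lemma smooth_on_divide:
  fixes f g :: "'a::real_normed_vector \<Rightarrow> real"
  assumes "open S" "\<And>x. x \<in> S \<Longrightarrow> g x \<noteq> 0" "smooth_on f S" "smooth_on g S"
  shows "smooth_on (\<lambda>x. f x / g x) S"
  using assms unfolding divide_inverse
  by (intro smooth_on_mult) (auto simp: smooth_on_def Ck_on_inverse)

lemma smooth_on_diff:
  assumes "open S" "smooth_on f S" "smooth_on g S"
  shows "smooth_on (\<lambda>x. f x - g x) S"
  using smooth_on_add[OF assms(1,2)
      smooth_on_bounded_linear[OF assms(1) bounded_linear_minus[OF bounded_linear_ident] assms(3)]]
  by simp

lemma smooth_on_sum:
  assumes "open S" "\<And>i. i \<in> I \<Longrightarrow> smooth_on (f i) S"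
  shows "smooth_on (\<lambda>x. \<Sum>i\<in>I. f i x) S"
  using assms(2)
  by (induction I rule: infinite_finite_induct)
    (auto intro: smooth_on_const smooth_on_add assms(1))

section \<open>Linear algebra with smooth coefficients\<close>

text \<open>Gaussian elimination: the Schur complement of a diagonal entry is again positive
  definite, so no pivot vanishes anywhere on \<open>S\<close>.\<close>

lemma smooth_solution_positive_definite:
  fixes G :: "'i \<Rightarrow> 'i \<Rightarrow> 'a::real_normed_vector \<Rightarrow> real"
  assumes "open S" "finite I"
    and "\<And>i j. i \<in> I \<Longrightarrow> j \<in> I \<Longrightarrow> smooth_on (G i j) S"
    and "\<And>i. i \<in> I \<Longrightarrow> smooth_on (b i) S"
    and "\<And>x y. x \<in> S \<Longrightarrow> \<exists>i\<in>I. y i \<noteq> 0 \<Longrightarrow> (\<Sum>i\<in>I. \<Sum>j\<in>I. y i * y j * G i j x) > 0"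
  shows "\<exists>a. (\<forall>i\<in>I. smooth_on (a i) S) \<and> (\<forall>x\<in>S. \<forall>i\<in>I. (\<Sum>j\<in>I. G i j x * a j x) = b i x)"
  using assms(2-)
proof (induction I arbitrary: G b rule: finite_induct)
  case empty
  then show ?case
    by auto
next
  case (insert m I)
  note fin = insert.hyps(1)
  \<comment> \<open>The quadratic form at the unit vector of index \<open>m\<close> is the diagonal
    entry.\<close>
  have piv: "G m m x > 0" if "x \<in> S" for x
  proof -
    have "(\<Sum>i\<in>insert m I. \<Sum>j\<in>insert m I. of_bool (i = m) * of_bool (j = m) * G i j x)
        = (\<Sum>i\<in>insert m I. \<Sum>j\<in>insert m I. if j = m then if i = m then G m m x else 0 else 0)"
      by (intro sum.cong) auto
    also have "\<dots> = G m m x"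
      using fin by (subst sum.delta) simp_all
    finally have "(\<Sum>i\<in>insert m I. \<Sum>j\<in>insert m I. of_bool (i = m) * of_bool (j = m) * G i j x) = G m m x" .
    with insert.prems(3)[OF that, of "\<lambda>i. of_bool (i = m)"] show ?thesis
      by auto
  qed
  \<comment> \<open>\<open>H\<close> and \<open>c\<close> result from subtracting the multiple of
    row \<open>m\<close> that removes the unknown of index \<open>m\<close> from row
    \<open>i\<close>.\<close>
  define H where "H i j x = G i j x - G i m x * G m j x / G m m x" for i j x
  define c where "c i x = b i x - G i m x * b m x / G m m x" for i x
  have "\<exists>a. (\<forall>i\<in>I. smooth_on (a i) S) \<and> (\<forall>x\<in>S. \<forall>i\<in>I. (\<Sum>j\<in>I. H i j x * a j x) = c i x)"
  proof (rule insert.IH)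
    show "smooth_on (H i j) S" if "i \<in> I" "j \<in> I" for i j
    proof -
      have "smooth_on (\<lambda>x. G i j x - G i m x * G m j x / G m m x) S"
        using that piv
        by (intro smooth_on_diff smooth_on_divide smooth_on_mult assms(1) insert.prems(1))
          (simp_all add: less_imp_neq[symmetric])
      then show ?thesis
        by (simp add: H_def[abs_def])
    qed
    show "smooth_on (c i) S" if "i \<in> I" for i
    proof -
      have "smooth_on (\<lambda>x. b i x - G i m x * b m x / G m m x) S"
        using that piv
        by (intro smooth_on_diff smooth_on_divide smooth_on_mult assms(1) insert.prems(1,2))
          (simp_all add: less_imp_neq[symmetric])
      then show ?thesis
        by (simp add: c_def[abs_def])
    qed
    fix x y
    assume x: "x \<in> S" and y: "\<exists>i\<in>I. (y i :: real) \<noteq> 0"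
    \<comment> \<open>The entry at \<open>m\<close> is chosen to make row \<open>m\<close> of
      \<open>G\<close> vanish on \<open>z\<close>; the form of \<open>G\<close> at \<open>z\<close>
      is then the form of \<open>H\<close> at \<open>y\<close>.\<close>
    define t where "t = - (\<Sum>j\<in>I. G m j x * y j) / G m m x"
    define z where "z = y(m := t)"
    have zI: "z i = y i" if "i \<in> I" for i
      using that insert.hyps(2) by (auto simp: z_def)
    have row_m: "(\<Sum>j\<in>insert m I. G m j x * z j) = 0"
      using fin insert.hyps(2) piv[OF x] by (simp add: zI) (simp add: z_def t_def)
    have row: "(\<Sum>j\<in>insert m I. G i j x * z j) = (\<Sum>j\<in>I. H i j x * y j)" for i
    proof -
      have "(\<Sum>j\<in>I. H i j x * y j)
          = (\<Sum>j\<in>I. G i j x * y j) - G i m x / G m m x * (\<Sum>j\<in>I. G m j x * y j)"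
        by (simp add: H_def algebra_simps sum_subtractf sum_distrib_left)
      then show ?thesis
        using fin insert.hyps(2) by (simp add: zI) (simp add: z_def t_def)
    qed
    have "0 < (\<Sum>i\<in>insert m I. \<Sum>j\<in>insert m I. z i * z j * G i j x)"
      using y zI by (intro insert.prems(3)[OF x]) auto
    also have "\<dots> = (\<Sum>i\<in>insert m I. z i * (\<Sum>j\<in>insert m I. G i j x * z j))"
      by (simp add: sum_distrib_left mult_ac)
    also have "\<dots> = (\<Sum>i\<in>I. z i * (\<Sum>j\<in>insert m I. G i j x * z j))"
      using fin insert.hyps(2) row_m by simp
    also have "\<dots> = (\<Sum>i\<in>I. \<Sum>j\<in>I. y i * y j * H i j x)"
      by (simp only: row) (simp add: zI sum_distrib_left mult_ac)
    finally show "0 < (\<Sum>i\<in>I. \<Sum>j\<in>I. y i * y j * H i j x)" .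
  qed
  then obtain a where a: "\<And>i. i \<in> I \<Longrightarrow> smooth_on (a i) S"
    "\<And>x i. x \<in> S \<Longrightarrow> i \<in> I \<Longrightarrow> (\<Sum>j\<in>I. H i j x * a j x) = c i x"
    by blast
  \<comment> \<open>Back substitution: row \<open>m\<close> solved for its own unknown.\<close>
  define t where "t x = (b m x - (\<Sum>j\<in>I. G m j x * a j x)) / G m m x" for x
  define z where "z = a(m := t)"
  have zI: "z i = a i" if "i \<in> I" for i
    using that insert.hyps(2) by (auto simp: z_def)
  have "smooth_on (\<lambda>x. (b m x - (\<Sum>j\<in>I. G m j x * a j x)) / G m m x) S"
    using piv
    by (intro smooth_on_diff smooth_on_divide smooth_on_mult smooth_on_sum assms(1)
        insert.prems(1,2) a(1)) (simp_all add: less_imp_neq[symmetric])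
  then have "smooth_on t S"
    by (simp add: t_def[abs_def])
  then have smooth_z: "smooth_on (z i) S" if "i \<in> insert m I" for i
    using a(1) that by (auto simp: z_def)
  have solves_z: "(\<Sum>j\<in>insert m I. G i j x * z j x) = b i x" if x: "x \<in> S" and i: "i \<in> insert m I" for x i
  proof -
    have split: "(\<Sum>j\<in>insert m I. G i j x * z j x) = G i m x * t x + (\<Sum>j\<in>I. G i j x * a j x)"
      using fin insert.hyps(2) by (simp add: zI) (simp add: z_def)
    show ?thesis
    proof (cases "i = m")
      case True
      then show ?thesis
        using split piv[OF x] by (simp add: t_def)
    next
      case False
      with i have "i \<in> I" by simp
      have "(\<Sum>j\<in>I. H i j x * a j x)
          = (\<Sum>j\<in>I. G i j x * a j x) - G i m x / G m m x * (\<Sum>j\<in>I. G m j x * a j x)"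
        by (simp add: H_def algebra_simps sum_subtractf sum_distrib_left)
      with a(2)[OF x \<open>i \<in> I\<close>] split show ?thesis
        using piv[OF x] by (simp add: c_def t_def diff_divide_distrib algebra_simps)
    qed
  qed
  show ?case
    by (rule exI[of _ z]) (intro conjI ballI smooth_z solves_z)
qed

text \<open>A constant matrix is a smooth family over the real line; the solution is evaluated at
  the arbitrary parameter \<open>0\<close>.\<close>

lemma solution_positive_definite:
  fixes G :: "'i \<Rightarrow> 'i \<Rightarrow> real"
  assumes "finite I"
    and "\<And>y. \<exists>i\<in>I. y i \<noteq> 0 \<Longrightarrow> (\<Sum>i\<in>I. \<Sum>j\<in>I. y i * y j * G i j) > 0"
  shows "\<exists>a. \<forall>i\<in>I. (\<Sum>j\<in>I. G i j * a j) = b i"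
proof -
  have "\<exists>a. (\<forall>i\<in>I. smooth_on (a i) UNIV) \<and>
      (\<forall>x\<in>UNIV::real set. \<forall>i\<in>I. (\<Sum>j\<in>I. G i j * a j x) = b i)"
    by (rule smooth_solution_positive_definite[of "UNIV :: real set" I "\<lambda>i j _. G i j" "\<lambda>i _. b i"])
      (simp_all add: assms smooth_on_const)
  then obtain a :: "'i \<Rightarrow> real \<Rightarrow> real" where
    "\<forall>x\<in>UNIV. \<forall>i\<in>I. (\<Sum>j\<in>I. G i j * a j x) = b i"
    by (elim exE conjE)
  then have "\<forall>i\<in>I. (\<Sum>j\<in>I. G i j * a j 0) = b i"
    by simp
  then show ?thesis
    by (rule exI[of _ "\<lambda>i. a i 0"])
qed

definition indep_family :: "'i set \<Rightarrow> ('i \<Rightarrow> 'v::real_vector) \<Rightarrow> bool" where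
  "indep_family I u \<longleftrightarrow> (\<forall>c. (\<Sum>i\<in>I. c i *\<^sub>R u i) = 0 \<longrightarrow> (\<forall>i\<in>I. c i = 0))"

lemma indep_familyD: "indep_family I u \<Longrightarrow> (\<Sum>i\<in>I. c i *\<^sub>R u i) = 0 \<Longrightarrow> i \<in> I \<Longrightarrow> c i = 0"
  by (auto simp: indep_family_def)

text \<open>\<open>smooth_subbundle\<close> speaks of injective families with independent image. The
  family form counts a repeated vector as a dependence and lets one index set serve the frames over
  all points.\<close>

lemma indep_family_iff:
  assumes "finite I"
  shows "indep_family I u \<longleftrightarrow> inj_on u I \<and> independent (u ` I)"
proof
  assume ind: "indep_family I u"
  have inj: "inj_on u I"
  proof (rule inj_onI, rule ccontr)
    fix i j
    assume ij: "i \<in> I" "j \<in> I" "u i = u j" "i \<noteq> j"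
    define c where "c l = (if l = i then 1 else if l = j then - 1 else 0 :: real)" for l
    have "(\<Sum>l\<in>I. c l *\<^sub>R u l) = (\<Sum>l\<in>{i, j}. c l *\<^sub>R u l)"
      using ij assms by (intro sum.mono_neutral_right) (auto simp: c_def)
    also have "\<dots> = 0"
      using ij by (simp add: c_def)
    finally show False
      using indep_familyD[OF ind _ ij(1), of c] by (simp add: c_def)
  qed
  moreover have "independent (u ` I)"
  proof
    assume "dependent (u ` I)"
    then obtain c v where v: "v \<in> u ` I" "c v \<noteq> 0" and s: "(\<Sum>v\<in>u ` I. c v *\<^sub>R v) = 0"
      using real_vector.dependent_finite[of "u ` I"] assms by blast
    from s have "(\<Sum>i\<in>I. c (u i) *\<^sub>R u i) = 0"
      by (simp add: sum.reindex[OF inj])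
    from indep_familyD[OF ind this] v show False
      by blast
  qed
  ultimately show "inj_on u I \<and> independent (u ` I)" ..
next
  assume *: "inj_on u I \<and> independent (u ` I)"
  show "indep_family I u"
    unfolding indep_family_def
  proof (intro allI impI ballI, rule ccontr)
    fix c i
    assume s: "(\<Sum>i\<in>I. c i *\<^sub>R u i) = 0" and i: "i \<in> I" "c i \<noteq> 0"
    define d where "d v = c (the_inv_into I u v)" for v
    have d: "d (u j) = c j" if "j \<in> I" for j
      using * that by (simp add: d_def the_inv_into_f_f)
    have "(\<Sum>v\<in>u ` I. d v *\<^sub>R v) = (\<Sum>i\<in>I. c i *\<^sub>R u i)"
      using * d by (simp add: sum.reindex)
    moreover have "d (u i) \<noteq> 0" "u i \<in> u ` I"
      using i d by simp_all
    ultimately have "(\<exists>v\<in>u ` I. d v \<noteq> 0) \<and> (\<Sum>v\<in>u ` I. d v *\<^sub>R v) = 0"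
      using s by auto
    with real_vector.dependent_finite[of "u ` I"] assms * show False
      by blast
  qed
qed

lemma span_family_iff:
  assumes "finite I"
  shows "x \<in> span (u ` I) \<longleftrightarrow> (\<exists>c. x = (\<Sum>i\<in>I. c i *\<^sub>R u i))"
proof
  assume "x \<in> span (u ` I)"
  then show "\<exists>c. x = (\<Sum>i\<in>I. c i *\<^sub>R u i)"
  proof (induction rule: span_induct_alt)
    case base
    have "0 = (\<Sum>i\<in>I. 0 *\<^sub>R u i)"
      by simp
    then show ?case
      by (rule exI[of _ "\<lambda>_. 0"])
  next
    case (step r y z)
    then obtain i c where i: "i \<in> I" "y = u i" "z = (\<Sum>i\<in>I. c i *\<^sub>R u i)"
      by auto
    have "(\<Sum>j\<in>I. (c(i := c i + r)) j *\<^sub>R u j) = (\<Sum>j\<in>I. c j *\<^sub>R u j + (if j = i then r *\<^sub>R u i else 0))"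
      by (intro sum.cong) (auto simp: scaleR_add_left)
    also have "\<dots> = r *\<^sub>R y + z"
      using i assms by (simp add: sum.distrib)
    finally show ?case
      by (intro exI[of _ "c(i := c i + r)"]) simp
  qed
next
  assume "\<exists>c. x = (\<Sum>i\<in>I. c i *\<^sub>R u i)"
  then obtain c where "x = (\<Sum>i\<in>I. c i *\<^sub>R u i)" ..
  then show "x \<in> span (u ` I)"
    by (simp add: span_sum span_scale span_base)
qed

text \<open>Normal equations: independence makes the Gram matrix of the \<open>U i x\<close>
  positive definite, whatever their number compared with the dimension of the target. The residual
  \<open>d\<close> of the solution is orthogonal to every \<open>U i x\<close> and also lies in
  their span, so it vanishes.\<close>

lemma smooth_coefficients:
  fixes U :: "'i \<Rightarrow> 'a::real_normed_vector \<Rightarrow> 'b::real_inner"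
  assumes "open S" "finite I" "\<And>i. i \<in> I \<Longrightarrow> smooth_on (U i) S" "smooth_on F S"
    and ind: "\<And>x. x \<in> S \<Longrightarrow> indep_family I (\<lambda>i. U i x)"
    and span: "\<And>x. x \<in> S \<Longrightarrow> F x \<in> span ((\<lambda>i. U i x) ` I)"
  shows "\<exists>a. (\<forall>i\<in>I. smooth_on (a i) S) \<and> (\<forall>x\<in>S. F x = (\<Sum>i\<in>I. a i x *\<^sub>R U i x))"
proof -
  have "\<exists>a. (\<forall>i\<in>I. smooth_on (a i) S) \<and>
      (\<forall>x\<in>S. \<forall>i\<in>I. (\<Sum>j\<in>I. inner (U i x) (U j x) * a j x) = inner (U i x) (F x))"
  proof (rule smooth_solution_positive_definite)
    fix x y
    assume x: "x \<in> S" and y: "\<exists>i\<in>I. (y i :: real) \<noteq> 0"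
    then have "(\<Sum>i\<in>I. y i *\<^sub>R U i x) \<noteq> 0"
      using indep_familyD[OF ind[OF x], of y] by auto
    then have "0 < inner (\<Sum>i\<in>I. y i *\<^sub>R U i x) (\<Sum>i\<in>I. y i *\<^sub>R U i x)"
      by simp
    also have "\<dots> = (\<Sum>i\<in>I. \<Sum>j\<in>I. y i * y j * inner (U i x) (U j x))"
      by (subst inner_sum_left) (simp add: inner_sum_right sum_distrib_left mult_ac)
    finally show "0 < (\<Sum>i\<in>I. \<Sum>j\<in>I. y i * y j * inner (U i x) (U j x))" .
  qed (use assms in \<open>auto intro: smooth_on_inner\<close>)
  then obtain a where a: "\<forall>i\<in>I. smooth_on (a i) S"
    "\<And>x i. x \<in> S \<Longrightarrow> i \<in> I \<Longrightarrow> (\<Sum>j\<in>I. inner (U i x) (U j x) * a j x) = inner (U i x) (F x)"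
    by blast
  have "F x = (\<Sum>i\<in>I. a i x *\<^sub>R U i x)" if x: "x \<in> S" for x
  proof -
    define d where "d = F x - (\<Sum>i\<in>I. a i x *\<^sub>R U i x)"
    have orth: "inner (U i x) d = 0" if "i \<in> I" for i
      using a(2)[OF x that] by (simp add: d_def inner_diff_right inner_sum_right mult.commute)
    have "(\<Sum>i\<in>I. a i x *\<^sub>R U i x) \<in> span ((\<lambda>i. U i x) ` I)"
      unfolding span_family_iff[OF assms(2)] by (rule exI[of _ "\<lambda>i. a i x"]) (rule refl)
    with span[OF x] have "d \<in> span ((\<lambda>i. U i x) ` I)"
      unfolding d_def by (rule span_diff)
    then obtain e where e: "d = (\<Sum>i\<in>I. e i *\<^sub>R U i x)"
      unfolding span_family_iff[OF assms(2)] by (rule exE)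
    have "inner (\<Sum>i\<in>I. e i *\<^sub>R U i x) d = 0"
      using orth by (simp add: inner_sum_left)
    then have "inner d d = 0"
      by (simp flip: e)
    then show ?thesis
      by (simp add: d_def)
  qed
  with a(1) show ?thesis
    by blast
qed

section \<open>Pointwise linear algebra\<close>

lemma scaleR_fun_apply [simp]: "(a *\<^sub>R f) x = a *\<^sub>R f x"
  by (simp add: scaleR_fun_def)

lemma sum_fun_apply: "(\<Sum>i\<in>I. f i) x = (\<Sum>i\<in>I. f i x)"
  by (induction I rule: infinite_finite_induct) auto

lemma subspace_linear_combination:
  "subspace T \<Longrightarrow> (\<And>i. i \<in> I \<Longrightarrow> u i \<in> T) \<Longrightarrow> (\<Sum>i\<in>I. a i *\<^sub>R u i) \<in> T"
  by (intro subspace_sum subspace_scale)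

lemma linear_form_on_sum:
  assumes "subspace T" "linear_form_on T f" "\<And>i. i \<in> I \<Longrightarrow> u i \<in> T"
  shows "f (\<Sum>i\<in>I. a i *\<^sub>R u i) = (\<Sum>i\<in>I. a i * f (u i))"
  using assms(3)
proof (induction I rule: infinite_finite_induct)
  case (insert i I)
  have "f (a i *\<^sub>R u i + (\<Sum>i\<in>I. a i *\<^sub>R u i)) = f (a i *\<^sub>R u i) + f (\<Sum>i\<in>I. a i *\<^sub>R u i)"
    using assms(2) insert.prems subspace_linear_combination[OF assms(1), of I u a]
      subspace_scale[OF assms(1), of "u i" "a i"]
    by (simp add: linear_form_on_def)
  then show ?case
    using insert assms(2) by (simp add: linear_form_on_def)
\<comment> \<open>Over an empty or infinite index set both sums are \<open>0\<close>, and
  \<open>f 0 = 0\<close> is homogeneity with factor \<open>0\<close>.\<close>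
qed (use assms(1,2) subspace_0[OF assms(1)] in \<open>force simp: linear_form_on_def dest: spec[of _ 0]\<close>)+

lemma linear_form_on_eqI:
  assumes "subspace T" "linear_form_on T f" "linear_form_on T f'" "finite I"
    and "\<And>i. i \<in> I \<Longrightarrow> u i \<in> T" "\<And>i. i \<in> I \<Longrightarrow> f (u i) = f' (u i)" "v \<in> T" "v \<in> span (u ` I)"
  shows "f v = f' v"
proof -
  obtain a where a: "v = (\<Sum>i\<in>I. a i *\<^sub>R u i)"
    using assms(8) unfolding span_family_iff[OF assms(4)] by (rule exE)
  show ?thesis
    using assms(5,6) linear_form_on_sum[OF assms(1,2), of I u a]
      linear_form_on_sum[OF assms(1,3), of I u a]
    by (simp add: a)
qed

section \<open>Inner products on a subspace\<close>

definition inner_product_on :: "'v::real_vector set \<Rightarrow> ('v \<Rightarrow> 'v \<Rightarrow> real) \<Rightarrow> bool" where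
  "inner_product_on T h \<longleftrightarrow> (\<forall>u\<in>T. linear_form_on T (h u)) \<and> (\<forall>u\<in>T. \<forall>v\<in>T. h u v = h v u) \<and>
     (\<forall>u\<in>T. u \<noteq> 0 \<longrightarrow> h u u > 0)"

text \<open>Tangent spaces are subspaces of one function type, with a product that changes from
  point to point. The inner product is therefore a parameter restricted to \<open>T\<close>, with no
  condition on \<open>h\<close> outside \<open>T\<close>.\<close>

locale inner_product_subspace =
  fixes T :: "'v::real_vector set" and h :: "'v \<Rightarrow> 'v \<Rightarrow> real"
  assumes subspace_T: "subspace T" and ip: "inner_product_on T h"
begin

lemma linear_right: "u \<in> T \<Longrightarrow> linear_form_on T (h u)"
  using ip by (simp add: inner_product_on_def)

lemma sym: "u \<in> T \<Longrightarrow> v \<in> T \<Longrightarrow> h u v = h v u"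
  using ip by (simp add: inner_product_on_def)

lemma pos: "u \<in> T \<Longrightarrow> u \<noteq> 0 \<Longrightarrow> h u u > 0"
  using ip by (simp add: inner_product_on_def)

lemma add_right: "u \<in> T \<Longrightarrow> v \<in> T \<Longrightarrow> w \<in> T \<Longrightarrow> h u (v + w) = h u v + h u w"
  using linear_right[of u] by (simp add: linear_form_on_def)

lemma scale_right: "u \<in> T \<Longrightarrow> v \<in> T \<Longrightarrow> h u (a *\<^sub>R v) = a * h u v"
  using linear_right[of u] by (simp add: linear_form_on_def)

lemma diff_right: "u \<in> T \<Longrightarrow> v \<in> T \<Longrightarrow> w \<in> T \<Longrightarrow> h u (v - w) = h u v - h u w"
  using add_right[of u v "(- 1) *\<^sub>R w"] scale_right[of u w "- 1"] subspace_neg[OF subspace_T, of w]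
  by simp

lemma scale_left: "u \<in> T \<Longrightarrow> v \<in> T \<Longrightarrow> h (a *\<^sub>R v) u = a * h v u"
  using scale_right[of u v a] sym subspace_scale[OF subspace_T] by metis

lemma diff_left: "u \<in> T \<Longrightarrow> v \<in> T \<Longrightarrow> w \<in> T \<Longrightarrow> h (v - w) u = h v u - h w u"
  using diff_right[of u v w] sym subspace_diff[OF subspace_T] by metis

lemma sum_right:
  "u \<in> T \<Longrightarrow> (\<And>i. i \<in> I \<Longrightarrow> v i \<in> T) \<Longrightarrow> h u (\<Sum>i\<in>I. a i *\<^sub>R v i) = (\<Sum>i\<in>I. a i * h u (v i))"
  by (rule linear_form_on_sum[OF subspace_T linear_right])

lemma sum_left:
  assumes "u \<in> T" "\<And>i. i \<in> I \<Longrightarrow> v i \<in> T"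
  shows "h (\<Sum>i\<in>I. a i *\<^sub>R v i) u = (\<Sum>i\<in>I. a i * h (v i) u)"
proof -
  have "h (\<Sum>i\<in>I. a i *\<^sub>R v i) u = h u (\<Sum>i\<in>I. a i *\<^sub>R v i)"
    by (rule sym) (use assms subspace_linear_combination[OF subspace_T] in auto)
  also have "\<dots> = (\<Sum>i\<in>I. a i * h u (v i))"
    by (rule sum_right[OF assms])
  also have "\<dots> = (\<Sum>i\<in>I. a i * h (v i) u)"
    using assms by (intro sum.cong refl) (simp add: sym[of u])
  finally show ?thesis .
qed

lemma sum_both:
  assumes "\<And>i. i \<in> I \<Longrightarrow> u i \<in> T"
  shows "h (\<Sum>i\<in>I. a i *\<^sub>R u i) (\<Sum>i\<in>I. a i *\<^sub>R u i) = (\<Sum>i\<in>I. \<Sum>j\<in>I. a i * a j * h (u i) (u j))"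
proof -
  have "h (\<Sum>i\<in>I. a i *\<^sub>R u i) (\<Sum>i\<in>I. a i *\<^sub>R u i) = (\<Sum>i\<in>I. a i * h (u i) (\<Sum>i\<in>I. a i *\<^sub>R u i))"
    by (intro sum_left subspace_linear_combination subspace_T assms)
  also have "\<dots> = (\<Sum>i\<in>I. \<Sum>j\<in>I. a i * a j * h (u i) (u j))"
    by (intro sum.cong refl) (simp add: sum_right[OF assms, of _ I u a] assms sum_distrib_left mult.assoc)
  finally show ?thesis .
qed

lemma eq_zero_iff: "u \<in> T \<Longrightarrow> h u u = 0 \<longleftrightarrow> u = 0"
  using pos[of u] scale_right[of u u 0] by force

lemma eqI:
  assumes "u \<in> T" "v \<in> T" "\<And>z. z \<in> T \<Longrightarrow> h u z = h v z"
  shows "u = v"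
proof -
  have "u - v \<in> T"
    using assms subspace_T by (intro subspace_diff)
  then have "h (u - v) (u - v) = 0"
    using assms by (simp add: diff_left)
  with \<open>u - v \<in> T\<close> show ?thesis
    using eq_zero_iff by auto
qed

lemma gram_positive_definite:
  assumes "indep_family I u" "\<And>i. i \<in> I \<Longrightarrow> u i \<in> T" "\<exists>i\<in>I. y i \<noteq> 0"
  shows "(\<Sum>i\<in>I. \<Sum>j\<in>I. y i * y j * h (u i) (u j)) > 0"
proof -
  have "(\<Sum>i\<in>I. y i *\<^sub>R u i) \<noteq> 0"
    using indep_familyD[OF assms(1), of y] assms(3) by blast
  then show ?thesis
    using pos[OF subspace_linear_combination[OF subspace_T, of I u y]] sum_both[of I u y] assms(2)
    by simp
qed

text \<open>The coefficients of the representing vector solve the Gram system with right-hand side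
  \<open>\<mu> (u i)\<close>; two linear forms agreeing on a spanning family agree on
  \<open>T\<close>.\<close>

lemma riesz:
  assumes "finite I" "indep_family I u" "\<And>i. i \<in> I \<Longrightarrow> u i \<in> T" "T \<subseteq> span (u ` I)"
    and "linear_form_on T \<mu>"
  shows "\<exists>z\<in>T. \<forall>v\<in>T. h z v = \<mu> v"
proof -
  obtain a where a: "\<forall>i\<in>I. (\<Sum>j\<in>I. h (u i) (u j) * a j) = \<mu> (u i)"
    using solution_positive_definite[OF assms(1) gram_positive_definite[OF assms(2,3)]] ..
  define z where "z = (\<Sum>j\<in>I. a j *\<^sub>R u j)"
  have z: "z \<in> T"
    unfolding z_def by (rule subspace_linear_combination[OF subspace_T assms(3)])
  have "h z (u i) = \<mu> (u i)" if i: "i \<in> I" for i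
  proof -
    have "h z (u i) = h (u i) z"
      using z assms(3)[OF i] by (rule sym)
    also have "\<dots> = (\<Sum>j\<in>I. a j * h (u i) (u j))"
      unfolding z_def by (rule sum_right[OF assms(3)[OF i] assms(3)])
    finally show ?thesis
      using a i by (simp add: mult.commute)
  qed
  then have "h z v = \<mu> v" if "v \<in> T" for v
    using linear_form_on_eqI[OF subspace_T linear_right[OF z] assms(5,1), of u v] that assms(3,4) by blast
  with z show ?thesis
    by blast
qed

text \<open>A Gram-Schmidt step: \<open>s\<close> is the orthogonal projection of \<open>t\<close>
  to the span, found from the Gram system, and \<open>t - s\<close> is nonzero because
  \<open>t\<close> lies outside the span. It remains to normalise.\<close>

lemma orthogonal_unit_vector:
  assumes "finite I" "indep_family I u" "\<And>i. i \<in> I \<Longrightarrow> u i \<in> T" "t \<in> T" "t \<notin> span (u ` I)"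
  shows "\<exists>a\<in>T. h a a = 1 \<and> (\<forall>i\<in>I. h a (u i) = 0)"
proof -
  obtain c where c: "\<forall>i\<in>I. (\<Sum>j\<in>I. h (u i) (u j) * c j) = h t (u i)"
    using solution_positive_definite[OF assms(1) gram_positive_definite[OF assms(2,3)]] ..
  define s where "s = (\<Sum>j\<in>I. c j *\<^sub>R u j)"
  have s: "s \<in> T"
    unfolding s_def by (rule subspace_linear_combination[OF subspace_T assms(3)])
  have "s \<in> span (u ` I)"
    unfolding span_family_iff[OF assms(1)] s_def by (rule exI) (rule refl)
  with assms(5) have ne: "t - s \<noteq> 0"
    by auto
  have ts: "t - s \<in> T"
    using subspace_diff[OF subspace_T assms(4) s] .
  have orth: "h (t - s) (u i) = 0" if i: "i \<in> I" for i
  proof -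
    have "h s (u i) = h (u i) s"
      using s assms(3)[OF i] by (rule sym)
    also have "\<dots> = (\<Sum>j\<in>I. c j * h (u i) (u j))"
      unfolding s_def by (rule sum_right[OF assms(3)[OF i] assms(3)])
    also have "\<dots> = h t (u i)"
      using c i by (simp add: mult.commute)
    finally show ?thesis
      by (simp add: diff_left[OF assms(3)[OF i] assms(4) s])
  qed
  define r where "r = 1 / sqrt (h (t - s) (t - s))"
  have "h (r *\<^sub>R (t - s)) (r *\<^sub>R (t - s)) = r * (r * h (t - s) (t - s))"
    using ts subspace_scale[OF subspace_T ts, of r] by (simp add: scale_left scale_right)
  also have "\<dots> = 1"
    using pos[OF ts ne] by (simp add: r_def)
  finally have "h (r *\<^sub>R (t - s)) (r *\<^sub>R (t - s)) = 1" .
  moreover have "\<forall>i\<in>I. h (r *\<^sub>R (t - s)) (u i) = 0"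
    using orth ts assms(3) by (simp add: scale_left)
  ultimately show ?thesis
    using subspace_scale[OF subspace_T ts, of r] by blast
qed

text \<open>Otherwise unit vectors orthogonal to all \<open>u i\<close> and to all \<open>w i\<close>, respectively, would
  extend the partial isometry.\<close>

lemma maximal_partial_isometry_total:
  assumes "finite I" "\<And>i. i \<in> I \<Longrightarrow> u i \<in> T" "\<And>i. i \<in> I \<Longrightarrow> w i \<in> T"
    and iso: "\<And>i j. i \<in> I \<Longrightarrow> j \<in> I \<Longrightarrow> h (u i) (u j) = h (w i) (w j)"
    and ind: "indep_family I u"
    and max: "\<And>a b. a \<in> T \<Longrightarrow> b \<in> T \<Longrightarrow> h a a = h b b \<Longrightarrow> \<forall>i\<in>I. h a (u i) = h b (w i) \<Longrightarrow>
      a \<in> span (u ` I)"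
  shows "T \<subseteq> span (u ` I)"
proof (rule ccontr)
  assume "\<not> T \<subseteq> span (u ` I)"
  then obtain t where t: "t \<in> T" "t \<notin> span (u ` I)"
    by blast
  \<comment> \<open>Equal Gram matrices give equal lengths to combinations with equal coefficients,
    so a relation among the \<open>w i\<close> is one among the \<open>u i\<close>.\<close>
  have ind_w: "indep_family I w"
    unfolding indep_family_def
  proof (intro allI impI)
    fix c
    assume c: "(\<Sum>i\<in>I. c i *\<^sub>R w i) = 0"
    have "h (\<Sum>i\<in>I. c i *\<^sub>R u i) (\<Sum>i\<in>I. c i *\<^sub>R u i) = (\<Sum>i\<in>I. \<Sum>j\<in>I. c i * c j * h (u i) (u j))"
      by (rule sum_both[OF assms(2)])
    also have "\<dots> = (\<Sum>i\<in>I. \<Sum>j\<in>I. c i * c j * h (w i) (w j))"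
      by (simp add: iso)
    also have "\<dots> = h (\<Sum>i\<in>I. c i *\<^sub>R w i) (\<Sum>i\<in>I. c i *\<^sub>R w i)"
      by (rule sum_both[OF assms(3), symmetric])
    also have "\<dots> = 0"
      using eq_zero_iff[OF subspace_0[OF subspace_T]] by (simp add: c)
    finally have "(\<Sum>i\<in>I. c i *\<^sub>R u i) = 0"
      using eq_zero_iff[OF subspace_linear_combination[OF subspace_T, of I u c]] assms(2) by simp
    then show "\<forall>i\<in>I. c i = 0"
      using ind by (simp add: indep_family_def)
  qed
  obtain a where a: "a \<in> T" "h a a = 1" "\<forall>i\<in>I. h a (u i) = 0"
    using orthogonal_unit_vector[OF assms(1) ind assms(2) t] by blast
  \<comment> \<open>If the \<open>w i\<close> spanned \<open>T\<close>, the independent vectors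
    \<open>t\<close> and \<open>u i\<close> would exceed in number the family that spans
    them.\<close>
  have "\<not> T \<subseteq> span (w ` I)"
  proof
    assume sub: "T \<subseteq> span (w ` I)"
    have u: "inj_on u I" "independent (u ` I)"
      using ind indep_family_iff[OF assms(1)] by auto
    have "t \<notin> u ` I"
      using t(2) span_base[of t "u ` I"] by blast
    have "independent (insert t (u ` I))"
      using u(2) t(2) by (simp add: independent_insert)
    moreover have "insert t (u ` I) \<subseteq> span (w ` I)"
      using sub t(1) assms(2) by blast
    ultimately have "card (insert t (u ` I)) \<le> card (w ` I)"
      using independent_span_bound[of "w ` I" "insert t (u ` I)"] assms(1) by blast
    also have "\<dots> \<le> card I"
      by (rule card_image_le[OF assms(1)])
    finally show False
      using \<open>t \<notin> u ` I\<close> assms(1) card_image[OF u(1)] by simp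
  qed
  then obtain t' where "t' \<in> T" "t' \<notin> span (w ` I)"
    by blast
  then obtain b where b: "b \<in> T" "h b b = 1" "\<forall>i\<in>I. h b (w i) = 0"
    using orthogonal_unit_vector[OF assms(1) ind_w assms(3)] by blast
  \<comment> \<open>The pair \<open>(a, b)\<close> satisfies the conditions of \<open>max\<close>:
    both lengths are \<open>1\<close> and all products are \<open>0\<close>. But a vector in the
    span of the \<open>u i\<close> and orthogonal to each of them has length
    \<open>0\<close>.\<close>
  have "a \<in> span (u ` I)"
    by (rule max[OF a(1) b(1)]) (use a b in auto)
  then obtain c where "a = (\<Sum>i\<in>I. c i *\<^sub>R u i)"
    unfolding span_family_iff[OF assms(1)] by (rule exE)
  then have "h a a = (\<Sum>i\<in>I. c i * h a (u i))"
    using sum_right[OF a(1), of I u c] assms(2) by simp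
  with a show False
    by simp
qed

end

section \<open>Tangent spaces in a chart\<close>

locale smooth_mfd =
  fixes n :: nat and M :: "('m, 'e::real_inner) premanifold"
  assumes smooth_mfd: "smooth_manifold n M"
begin

text \<open>One basis, fixed once and indexed by its own elements, supplies the coordinate frame of
  every chart.\<close>

definition model_basis :: "'e set" where
  "model_basis = (SOME B. finite B \<and> independent B \<and> span B = UNIV)"

lemma model_basis: "finite model_basis" "independent model_basis" "span model_basis = UNIV"
proof -
  have "\<exists>B::'e set. finite B \<and> independent B \<and> span B = UNIV"
    using smooth_mfd unfolding smooth_manifold_def by blast
  then have "finite model_basis \<and> independent model_basis \<and> span model_basis = UNIV"
    unfolding model_basis_def by (rule someI_ex)
  then show "finite model_basis" "independent model_basis" "span model_basis = UNIV"
    by simp_all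
qed

lemma indep_model_basis: "indep_family model_basis (\<lambda>b. b)"
  using model_basis by (simp add: indep_family_iff)

lemma chart: "c \<in> atlas M \<Longrightarrow> is_chart (mtop M) c"
  using smooth_mfd unfolding smooth_manifold_def by blast

lemma chart_exists:
  assumes "p \<in> points M"
  obtains c where "c \<in> charts_at M p"
  using smooth_mfd assms unfolding smooth_manifold_def charts_at_def by blast

lemma charts_atD: "c \<in> charts_at M p \<Longrightarrow> c \<in> atlas M" "c \<in> charts_at M p \<Longrightarrow> p \<in> fst c"
  by (simp_all add: charts_at_def)

lemma openin_chart: "c \<in> atlas M \<Longrightarrow> openin (mtop M) (fst c)"
  using chart by (simp add: is_chart_def)

lemma chart_subset: "c \<in> atlas M \<Longrightarrow> fst c \<subseteq> points M"
  using openin_chart openin_subset by blast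

lemma inj_on_chart:
  assumes "c \<in> atlas M"
  shows "inj_on (snd c) (fst c)"
  using homeomorphic_imp_injective_map[of "subtopology (mtop M) (fst c)"] chart[OF assms]
    chart_subset[OF assms]
  by (auto simp: is_chart_def Int_absorb1)

lemma chart_inv [simp]: "c \<in> atlas M \<Longrightarrow> p \<in> fst c \<Longrightarrow> chart_inv c (snd c p) = p"
  by (simp add: chart_inv_def inj_on_chart)

lemma open_chart_image:
  assumes "c \<in> atlas M" "openin (mtop M) W"
  shows "open (snd c ` (fst c \<inter> W))"
proof -
  have "open_map (subtopology (mtop M) (fst c)) (top_of_set (snd c ` fst c)) (snd c)"
    using chart[OF assms(1)] unfolding is_chart_def by (blast intro: homeomorphic_imp_open_map)
  then have "openin (top_of_set (snd c ` fst c)) (snd c ` (fst c \<inter> W))"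
    using openin_subtopology_Int2[OF assms(2), of "fst c"] unfolding open_map_def by blast
  moreover have "open (snd c ` fst c)"
    using chart[OF assms(1)] by (simp add: is_chart_def)
  ultimately show ?thesis
    by (rule openin_open_trans)
qed

lemma transition_has_derivative:
  assumes "c \<in> charts_at M p" "d \<in> charts_at M p"
  shows "(transition c d has_derivative frechet_derivative (transition c d) (at (snd c p))) (at (snd c p))"
proof -
  have "Ck_on (Suc 0) (transition c d) (snd c ` (fst c \<inter> fst d))"
    using assms smooth_mfd unfolding smooth_manifold_def smooth_on_def by (simp only: charts_atD)
  moreover have "snd c p \<in> snd c ` (fst c \<inter> fst d)"
    using assms by (simp add: charts_atD)
  ultimately show ?thesis
    by (rule Ck_on_Suc_has_derivative)
qed

lemma linear_transition_derivative:
  "c \<in> charts_at M p \<Longrightarrow> d \<in> charts_at M p \<Longrightarrow>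
    linear (frechet_derivative (transition c d) (at (snd c p)))"
  using transition_has_derivative has_derivative_linear by blast

text \<open>The chain rule, applied on the open coordinate image of the common domain of the three
  charts, where the transitions compose.\<close>

lemma transition_derivative_cocycle:
  assumes c: "c \<in> charts_at M p" and d: "d \<in> charts_at M p" and d': "d' \<in> charts_at M p"
  shows "frechet_derivative (transition d d') (at (snd d p))
      (frechet_derivative (transition c d) (at (snd c p)) e)
    = frechet_derivative (transition c d') (at (snd c p)) e"
proof -
  note at = charts_atD[OF c] charts_atD[OF d] charts_atD[OF d']
  have cd: "transition c d (snd c q) = snd d q" if "q \<in> fst c" for d q
    using at that by (simp add: transition_def)
  let ?D = "frechet_derivative (transition d d') (at (snd d p)) \<circ>
    frechet_derivative (transition c d) (at (snd c p))"
  have "(transition d d' \<circ> transition c d has_derivative ?D) (at (snd c p))"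
    using transition_has_derivative[OF c d] transition_has_derivative[OF d d'] at
    by (intro diff_chain_at) (simp_all add: cd)
  moreover have "open (snd c ` (fst c \<inter> (fst d \<inter> fst d')))"
    using at by (intro open_chart_image openin_Int openin_chart)
  moreover have "snd c p \<in> snd c ` (fst c \<inter> (fst d \<inter> fst d'))"
    using at by simp
  moreover have "(transition d d' \<circ> transition c d) x = transition c d' x"
    if x: "x \<in> snd c ` (fst c \<inter> (fst d \<inter> fst d'))" for x
  proof -
    obtain q where "q \<in> fst c" "q \<in> fst d" "q \<in> fst d'" "x = snd c q"
      using x by blast
    then show ?thesis
      using at by (simp add: cd) (simp add: transition_def)
  qed
  ultimately have "(transition c d' has_derivative ?D) (at (snd c p))"
    by (rule has_derivative_transform_within_open)
  then have "?D = frechet_derivative (transition c d') (at (snd c p))"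
    by (rule frechet_derivative_at)
  then show ?thesis
    by (metis comp_apply)
qed

lemma transition_derivative_self:
  assumes c: "c \<in> charts_at M p"
  shows "frechet_derivative (transition c c) (at (snd c p)) e = e"
proof -
  note at = charts_atD[OF c]
  have "((\<lambda>x. x) has_derivative (\<lambda>e. e)) (at (snd c p))"
    by (rule has_derivative_ident)
  moreover have "open (snd c ` fst c)"
    using chart[OF at(1)] by (simp add: is_chart_def)
  moreover have "snd c p \<in> snd c ` fst c"
    using at by simp
  moreover have "x = transition c c x" if "x \<in> snd c ` fst c" for x
    using that at by (auto simp: transition_def)
  ultimately have "(transition c c has_derivative (\<lambda>e. e)) (at (snd c p))"
    by (rule has_derivative_transform_within_open)
  then show ?thesis
    using frechet_derivative_at by metis
qed

lemma tangent_spaceD: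
  assumes "v \<in> tangent_space M p"
  shows "c \<notin> charts_at M p \<Longrightarrow> v c = 0"
    and "c \<in> charts_at M p \<Longrightarrow> d \<in> charts_at M p \<Longrightarrow>
      frechet_derivative (transition c d) (at (snd c p)) (v c) = v d"
proof -
  note * = assms[unfolded tangent_space_def mem_Collect_eq]
  show "v c = 0" if "c \<notin> charts_at M p"
    using * that by blast
  show "frechet_derivative (transition c d) (at (snd c p)) (v c) = v d"
    if "c \<in> charts_at M p" "d \<in> charts_at M p"
    by (rule conjunct2[OF *, THEN bspec, OF that(1), THEN bspec, OF that(2), symmetric])
qed

lemma tangent_spaceI:
  assumes "\<And>c. c \<notin> charts_at M p \<Longrightarrow> v c = 0"
    and "\<And>c d. c \<in> charts_at M p \<Longrightarrow> d \<in> charts_at M p \<Longrightarrow>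
      frechet_derivative (transition c d) (at (snd c p)) (v c) = v d"
  shows "v \<in> tangent_space M p"
  unfolding tangent_space_def mem_Collect_eq by (intro conjI allI impI ballI assms assms(2)[symmetric])

lemma subspace_tangent_space: "subspace (tangent_space M p)"
proof (rule subspaceI)
  show "0 \<in> tangent_space M p"
    by (rule tangent_spaceI) (simp_all add: linear_0[OF linear_transition_derivative])
  show "u + v \<in> tangent_space M p" if "u \<in> tangent_space M p" "v \<in> tangent_space M p" for u v
    by (rule tangent_spaceI)
      (simp_all add: linear_add[OF linear_transition_derivative] tangent_spaceD[OF that(1)]
        tangent_spaceD[OF that(2)])
  show "a *\<^sub>R v \<in> tangent_space M p" if "v \<in> tangent_space M p" for a v
    by (rule tangent_spaceI)
      (simp_all add: linear_scale[OF linear_transition_derivative] tangent_spaceD[OF that])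
qed

lemma tangent_eqI:
  assumes "c \<in> charts_at M p" "u \<in> tangent_space M p" "v \<in> tangent_space M p" "u c = v c"
  shows "u = v"
proof
  fix d
  show "u d = v d"
  proof (cases "d \<in> charts_at M p")
    case True
    from tangent_spaceD(2)[OF assms(2,1) this] tangent_spaceD(2)[OF assms(3,1) this] assms(4)
    show ?thesis
      by simp
  next
    case False
    then show ?thesis
      by (simp add: tangent_spaceD(1)[OF assms(2)] tangent_spaceD(1)[OF assms(3)])
  qed
qed

lemma coord_vec:
  assumes c: "c \<in> charts_at M p"
  shows "coord_vec M c e p \<in> tangent_space M p" "coord_vec M c e p c = e"
proof -
  \<comment> \<open>The vector \<open>e\<close> is carried to every other chart around
    \<open>p\<close> by the derivative of the transition; the cocycle identity makes the result a
    tangent vector.\<close>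
  define v where
    "v d = (if d \<in> charts_at M p then frechet_derivative (transition c d) (at (snd c p)) e else 0)" for d
  have "frechet_derivative (transition d d') (at (snd d p)) (v d) = v d'"
    if "d \<in> charts_at M p" "d' \<in> charts_at M p" for d d'
    using transition_derivative_cocycle[OF c that] that by (simp add: v_def)
  then have v: "v \<in> tangent_space M p"
    by (intro tangent_spaceI) (simp_all add: v_def)
  moreover have vc: "v c = e"
    using c transition_derivative_self[OF c] by (simp add: v_def)
  ultimately have "coord_vec M c e p = v"
    unfolding coord_vec_def using tangent_eqI[OF c] by (intro the_equality) simp_all
  with v vc show "coord_vec M c e p \<in> tangent_space M p" "coord_vec M c e p c = e"
    by simp_all
qed

text \<open>A tangent vector is determined by its coordinates in one chart, so coefficients computed
  in coordinates are valid for the vectors themselves.\<close>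

lemma tangent_eq_sum:
  assumes "c \<in> charts_at M p" "v \<in> tangent_space M p" "\<And>i. i \<in> I \<Longrightarrow> u i \<in> tangent_space M p"
    and "v c = (\<Sum>i\<in>I. a i *\<^sub>R u i c)"
  shows "v = (\<Sum>i\<in>I. a i *\<^sub>R u i)"
  by (rule tangent_eqI[OF assms(1,2)])
    (simp_all add: assms subspace_linear_combination subspace_tangent_space sum_fun_apply)

lemma coord_vec_family:
  assumes c: "c \<in> charts_at M p"
  shows "indep_family model_basis (\<lambda>b. coord_vec M c b p)"
    and "tangent_space M p \<subseteq> span ((\<lambda>b. coord_vec M c b p) ` model_basis)"
proof -
  show "indep_family model_basis (\<lambda>b. coord_vec M c b p)"
    unfolding indep_family_def
  proof (intro allI impI)
    fix a
    assume "(\<Sum>b\<in>model_basis. a b *\<^sub>R coord_vec M c b p) = 0"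
    then have "(\<Sum>b\<in>model_basis. a b *\<^sub>R coord_vec M c b p) c = 0"
      by simp
    then have "(\<Sum>b\<in>model_basis. a b *\<^sub>R b) = 0"
      by (simp add: sum_fun_apply coord_vec[OF c])
    then show "\<forall>b\<in>model_basis. a b = 0"
      using indep_model_basis by (simp add: indep_family_def)
  qed
  show "tangent_space M p \<subseteq> span ((\<lambda>b. coord_vec M c b p) ` model_basis)"
  proof
    fix v
    assume v: "v \<in> tangent_space M p"
    have "v c \<in> span ((\<lambda>b. b) ` model_basis)"
      by (simp add: model_basis)
    then obtain a where "v c = (\<Sum>b\<in>model_basis. a b *\<^sub>R b)"
      unfolding span_family_iff[OF model_basis(1)] by (rule exE)
    then have "v = (\<Sum>b\<in>model_basis. a b *\<^sub>R coord_vec M c b p)"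
      using v by (intro tangent_eq_sum[OF c]) (simp_all add: coord_vec[OF c])
    then show "v \<in> span ((\<lambda>b. coord_vec M c b p) ` model_basis)"
      unfolding span_family_iff[OF model_basis(1)] by (intro exI[of _ a])
  qed
qed

section \<open>Smooth vector fields\<close>

lemma smooth_vector_fieldD:
  assumes "smooth_vector_field M W X"
  shows "p \<in> W \<Longrightarrow> X p \<in> tangent_space M p"
    and "c \<in> atlas M \<Longrightarrow> smooth_on (\<lambda>x. X (chart_inv c x) c) (snd c ` (fst c \<inter> W))"
  using assms by (simp_all add: smooth_vector_field_def)

lemma chart_image_point:
  assumes "c \<in> atlas M" "x \<in> snd c ` (fst c \<inter> W)"
  shows "c \<in> charts_at M (chart_inv c x)" "chart_inv c x \<in> W"
  using assms by (auto simp: charts_at_def)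

lemma smooth_vector_field_subset:
  assumes "smooth_vector_field M W X" "V \<subseteq> W"
  shows "smooth_vector_field M V X"
  unfolding smooth_vector_field_def
proof (intro conjI ballI)
  show "X p \<in> tangent_space M p" if "p \<in> V" for p
    using assms that by (auto simp: smooth_vector_field_def)
  show "smooth_on (\<lambda>x. X (chart_inv c x) c) (snd c ` (fst c \<inter> V))" if c: "c \<in> atlas M" for c
    by (rule smooth_on_subset[OF smooth_vector_fieldD(2)[OF assms(1) c]]) (use assms(2) in blast)
qed

lemma smooth_vector_field_add:
  assumes "openin (mtop M) W" "smooth_vector_field M W X" "smooth_vector_field M W Y"
  shows "smooth_vector_field M W (\<lambda>p. X p + Y p)"
  using assms(2,3) open_chart_image[OF _ assms(1)]
  by (simp add: smooth_vector_field_def subspace_add[OF subspace_tangent_space] smooth_on_add)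

lemma smooth_vector_field_scale:
  assumes "openin (mtop M) W" "smooth_vector_field M W X"
  shows "smooth_vector_field M W (\<lambda>p. a *\<^sub>R X p)"
  using assms(2) open_chart_image[OF _ assms(1)]
  by (simp add: smooth_vector_field_def subspace_scale[OF subspace_tangent_space] smooth_on_scaleR_const)

text \<open>Frames exist only over small open sets, so the smoothness of the image of a global field
  has to be checked piece by piece.\<close>

lemma smooth_vector_field_local:
  assumes "\<And>p. p \<in> W \<Longrightarrow> \<exists>V. openin (mtop M) V \<and> p \<in> V \<and> smooth_vector_field M V X"
  shows "smooth_vector_field M W X"
  unfolding smooth_vector_field_def
proof (intro conjI ballI)
  show "X p \<in> tangent_space M p" if p: "p \<in> W" for p
    using assms[OF p] by (auto simp: smooth_vector_field_def)
  fix c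
  assume c: "c \<in> atlas M"
  show "smooth_on (\<lambda>x. X (chart_inv c x) c) (snd c ` (fst c \<inter> W))"
  proof (rule smooth_on_local)
    fix x
    assume "x \<in> snd c ` (fst c \<inter> W)"
    then obtain p where p: "p \<in> fst c" "p \<in> W" "x = snd c p"
      by blast
    obtain V where V: "openin (mtop M) V" "p \<in> V" "smooth_vector_field M V X"
      using assms[OF p(2)] by blast
    have "open (snd c ` (fst c \<inter> V))" "x \<in> snd c ` (fst c \<inter> V)"
      using open_chart_image[OF c V(1)] p V(2) by auto
    with smooth_vector_fieldD(2)[OF V(3) c]
    show "\<exists>N. open N \<and> x \<in> N \<and> smooth_on (\<lambda>x. X (chart_inv c x) c) N"
      by (intro exI[of _ "snd c ` (fst c \<inter> V)"]) simp
  qed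
qed

text \<open>Over \<open>W\<close>, the relation \<open>R q\<close> is the graph of the linear map
  that sends the frame vector \<open>u i q\<close> to \<open>w i q\<close>. Keeping \<open>R\<close>
  abstract allows the relation of a Dirac structure and its converse to be treated alike.\<close>

definition graph_frame ::
    "('m \<Rightarrow> ('m, 'e) tvec \<Rightarrow> ('m, 'e) tvec \<Rightarrow> bool) \<Rightarrow> 'm set \<Rightarrow> nat \<Rightarrow>
     (nat \<Rightarrow> 'm \<Rightarrow> ('m, 'e) tvec) \<Rightarrow> (nat \<Rightarrow> 'm \<Rightarrow> ('m, 'e) tvec) \<Rightarrow> bool" where
  "graph_frame R W k u w \<longleftrightarrow>
     (\<forall>i<k. smooth_vector_field M W (u i)) \<and> (\<forall>i<k. smooth_vector_field M W (w i)) \<and>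
     (\<forall>q\<in>W. indep_family {..<k} (\<lambda>i. u i q)) \<and>
     (\<forall>q\<in>W. tangent_space M q \<subseteq> span ((\<lambda>i. u i q) ` {..<k})) \<and>
     (\<forall>q\<in>W. \<forall>a b. R q a b \<longleftrightarrow>
       (\<exists>c. a = (\<Sum>i\<in>{..<k}. c i *\<^sub>R u i q) \<and> b = (\<Sum>i\<in>{..<k}. c i *\<^sub>R w i q)))"

definition locally_graph :: "('m \<Rightarrow> ('m, 'e) tvec \<Rightarrow> ('m, 'e) tvec \<Rightarrow> bool) \<Rightarrow> bool" where
  "locally_graph R \<longleftrightarrow> (\<forall>p\<in>points M. \<exists>W k u w. openin (mtop M) W \<and> p \<in> W \<and> graph_frame R W k u w)"

text \<open>The value at \<open>p\<close> depends on \<open>X\<close> only through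
  \<open>X p\<close>. The value \<open>0\<close> at non-points is the convention of
  \<open>vector_fields\<close>.\<close>

definition apply_relation ::
    "('m \<Rightarrow> ('m, 'e) tvec \<Rightarrow> ('m, 'e) tvec \<Rightarrow> bool) \<Rightarrow> ('m \<Rightarrow> ('m, 'e) tvec) \<Rightarrow> 'm \<Rightarrow> ('m, 'e) tvec"
  where "apply_relation R X p = (if p \<in> points M then (THE b. R p (X p) b) else 0)"

text \<open>Independence of the \<open>u i q\<close> determines the coefficients, so the relation is
  single-valued.\<close>

lemma graph_frame_unique:
  assumes gf: "graph_frame R W k u w" and q: "q \<in> W" and "R q (\<Sum>i\<in>{..<k}. c i *\<^sub>R u i q) b"
  shows "b = (\<Sum>i\<in>{..<k}. c i *\<^sub>R w i q)"
proof -
  have "\<exists>d. (\<Sum>i\<in>{..<k}. c i *\<^sub>R u i q) = (\<Sum>i\<in>{..<k}. d i *\<^sub>R u i q) \<and>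
      b = (\<Sum>i\<in>{..<k}. d i *\<^sub>R w i q)"
    using assms unfolding graph_frame_def by simp
  then obtain d where eq: "(\<Sum>i\<in>{..<k}. c i *\<^sub>R u i q) = (\<Sum>i\<in>{..<k}. d i *\<^sub>R u i q)"
    and b: "b = (\<Sum>i\<in>{..<k}. d i *\<^sub>R w i q)"
    by (elim exE conjE)
  have "(\<Sum>i\<in>{..<k}. (c i - d i) *\<^sub>R u i q) = 0"
    using eq by (simp add: scaleR_diff_left sum_subtractf)
  moreover have "indep_family {..<k} (\<lambda>i. u i q)"
    using gf q by (simp add: graph_frame_def)
  ultimately have "c i - d i = 0" if "i \<in> {..<k}" for i
    using indep_familyD[of "{..<k}" "\<lambda>i. u i q" "\<lambda>i. c i - d i"] that by blast
  then show ?thesis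
    unfolding b by (intro sum.cong) auto
qed

lemma graph_frame_apply:
  assumes gf: "graph_frame R W k u w" and q: "q \<in> W" "q \<in> points M"
    and X: "X q = (\<Sum>i\<in>{..<k}. c i *\<^sub>R u i q)"
  shows "apply_relation R X q = (\<Sum>i\<in>{..<k}. c i *\<^sub>R w i q)"
proof -
  have "\<exists>d. X q = (\<Sum>i\<in>{..<k}. d i *\<^sub>R u i q) \<and>
      (\<Sum>i\<in>{..<k}. c i *\<^sub>R w i q) = (\<Sum>i\<in>{..<k}. d i *\<^sub>R w i q)"
    by (intro exI[of _ c] conjI X refl)
  then have "R q (X q) (\<Sum>i\<in>{..<k}. c i *\<^sub>R w i q)"
    using gf q unfolding graph_frame_def by simp
  then have "(THE b. R q (X q) b) = (\<Sum>i\<in>{..<k}. c i *\<^sub>R w i q)"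
    using graph_frame_unique[OF gf q(1)] unfolding X by (intro the_equality)
  then show ?thesis
    using q by (simp add: apply_relation_def)
qed

lemma graph_frame_coefficients:
  assumes gf: "graph_frame R W k u w" and q: "q \<in> W" and v: "v \<in> tangent_space M q"
  obtains c where "v = (\<Sum>i\<in>{..<k}. c i *\<^sub>R u i q)"
proof -
  have "v \<in> span ((\<lambda>i. u i q) ` {..<k})"
    using assms by (auto simp: graph_frame_def)
  then show ?thesis
    unfolding span_family_iff[OF finite_lessThan] by (elim exE that)
qed

lemma apply_relation_iff:
  assumes "locally_graph R" "p \<in> points M" "X p \<in> tangent_space M p"
  shows "R p (X p) b \<longleftrightarrow> b = apply_relation R X p"
proof -
  obtain W k u w where W: "p \<in> W" and gf: "graph_frame R W k u w"
    using assms(1,2) unfolding locally_graph_def by blast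
  obtain c where X: "X p = (\<Sum>i\<in>{..<k}. c i *\<^sub>R u i p)"
    using graph_frame_coefficients[OF gf W assms(3)] .
  have "R p (X p) (\<Sum>i\<in>{..<k}. c i *\<^sub>R w i p)"
    using gf W X unfolding graph_frame_def by auto
  then show ?thesis
    using graph_frame_unique[OF gf W, of c b] graph_frame_apply[where X = X and c = c, OF gf W assms(2) X] X by auto
qed

lemma apply_relation_smooth:
  assumes R: "locally_graph R" and X: "X \<in> vector_fields M"
  shows "apply_relation R X \<in> vector_fields M"
proof -
  have smooth_X: "smooth_vector_field M (points M) X"
    using X by (simp add: vector_fields_def)
  have "smooth_vector_field M (points M) (apply_relation R X)"
  proof (rule smooth_vector_field_local)
    fix p
    assume "p \<in> points M"
    then obtain W k u w where W: "openin (mtop M) W" "p \<in> W" and gf: "graph_frame R W k u w"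
      using R unfolding locally_graph_def by blast
    have W_sub: "W \<subseteq> points M"
      using W(1) by (rule openin_subset)
    have X_W: "smooth_vector_field M W X"
      by (rule smooth_vector_field_subset[OF smooth_X W_sub])
    have u: "smooth_vector_field M W (u i)" and w: "smooth_vector_field M W (w i)" if "i \<in> {..<k}" for i
      using gf that by (simp_all add: graph_frame_def)
    have "smooth_vector_field M W (apply_relation R X)"
      unfolding smooth_vector_field_def
    proof (intro conjI ballI)
      fix q
      assume q: "q \<in> W"
      obtain c where "X q = (\<Sum>i\<in>{..<k}. c i *\<^sub>R u i q)"
        using graph_frame_coefficients[OF gf q smooth_vector_fieldD(1)[OF X_W q]] .
      then have "apply_relation R X q = (\<Sum>i\<in>{..<k}. c i *\<^sub>R w i q)"
        using W_sub q by (intro graph_frame_apply[OF gf q]) auto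
      then show "apply_relation R X q \<in> tangent_space M q"
        using smooth_vector_fieldD(1)[OF w q]
        using subspace_linear_combination[OF subspace_tangent_space, of "{..<k}" "\<lambda>i. w i q" q c]
        by simp
    next
      fix c
      assume c: "c \<in> atlas M"
      let ?S = "snd c ` (fst c \<inter> W)"
      have S: "open ?S"
        by (rule open_chart_image[OF c W(1)])
      have at: "c \<in> charts_at M (chart_inv c x)" "chart_inv c x \<in> W" "chart_inv c x \<in> points M"
        if "x \<in> ?S" for x
        using chart_image_point[OF c that] W_sub by auto
      \<comment> \<open>The coordinates of the frame in \<open>c\<close> form an independent family
        in the model space, where the normal equations are available. The resulting coefficients are
        then transferred unchanged from the \<open>u i\<close> to the \<open>w i\<close>.\<close>
      have "\<exists>a. (\<forall>i\<in>{..<k}. smooth_on (a i) ?S) \<and>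
          (\<forall>x\<in>?S. X (chart_inv c x) c = (\<Sum>i\<in>{..<k}. a i x *\<^sub>R u i (chart_inv c x) c))"
      proof (rule smooth_coefficients[OF S finite_lessThan])
        show "smooth_on (\<lambda>x. u i (chart_inv c x) c) ?S" if "i \<in> {..<k}" for i
          by (rule smooth_vector_fieldD(2)[OF u[OF that] c])
        show "smooth_on (\<lambda>x. X (chart_inv c x) c) ?S"
          by (rule smooth_vector_fieldD(2)[OF X_W c])
        fix x
        assume x: "x \<in> ?S"
        let ?q = "chart_inv c x"
        have uT: "u i ?q \<in> tangent_space M ?q" if "i \<in> {..<k}" for i
          by (rule smooth_vector_fieldD(1)[OF u[OF that] at(2)[OF x]])
        show "indep_family {..<k} (\<lambda>i. u i ?q c)"
          unfolding indep_family_def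
        proof (intro allI impI)
          fix a
          assume "(\<Sum>i\<in>{..<k}. a i *\<^sub>R u i ?q c) = 0"
          \<comment> \<open>A relation between coordinates in this one chart is a relation between
            tangent vectors.\<close>
          then have "0 = (\<Sum>i\<in>{..<k}. a i *\<^sub>R u i ?q)"
            by (intro tangent_eq_sum[OF at(1)[OF x] subspace_0[OF subspace_tangent_space] uT]) simp_all
          moreover have "indep_family {..<k} (\<lambda>i. u i ?q)"
            using gf at(2)[OF x] by (simp add: graph_frame_def)
          ultimately show "\<forall>i\<in>{..<k}. a i = 0"
            unfolding indep_family_def by (metis (no_types, lifting))
        qed
        obtain a where "X ?q = (\<Sum>i\<in>{..<k}. a i *\<^sub>R u i ?q)"
          using graph_frame_coefficients[OF gf at(2)[OF x] smooth_vector_fieldD(1)[OF X_W at(2)[OF x]]] .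
        then have "X ?q c = (\<Sum>i\<in>{..<k}. a i *\<^sub>R u i ?q c)"
          by (simp add: sum_fun_apply)
        then show "X ?q c \<in> span ((\<lambda>i. u i ?q c) ` {..<k})"
          unfolding span_family_iff[OF finite_lessThan] by (intro exI[of _ a])
      qed
      then obtain a where a: "\<And>i. i \<in> {..<k} \<Longrightarrow> smooth_on (a i) ?S"
        "\<And>x. x \<in> ?S \<Longrightarrow> X (chart_inv c x) c = (\<Sum>i\<in>{..<k}. a i x *\<^sub>R u i (chart_inv c x) c)"
        by auto
      have "(\<Sum>i\<in>{..<k}. a i x *\<^sub>R w i (chart_inv c x) c) = apply_relation R X (chart_inv c x) c"
        if x: "x \<in> ?S" for x
      proof -
        let ?q = "chart_inv c x"
        have "X ?q = (\<Sum>i\<in>{..<k}. a i x *\<^sub>R u i ?q)"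
          by (rule tangent_eq_sum[OF at(1)[OF x] smooth_vector_fieldD(1)[OF X_W at(2)[OF x]]])
            (use smooth_vector_fieldD(1)[OF u at(2)[OF x]] a(2)[OF x] in auto)
        from graph_frame_apply[where X = X, OF gf at(2,3)[OF x] this] show ?thesis
          by (simp add: sum_fun_apply)
      qed
      moreover have "smooth_on (\<lambda>x. \<Sum>i\<in>{..<k}. a i x *\<^sub>R w i (chart_inv c x) c) ?S"
        by (intro smooth_on_sum[OF S] smooth_on_scaleR[OF S] a(1) smooth_vector_fieldD(2)[OF w c])
      ultimately show "smooth_on (\<lambda>x. apply_relation R X (chart_inv c x) c) ?S"
        by (rule smooth_on_cong[OF S])
    qed
    with W show "\<exists>V. openin (mtop M) V \<and> p \<in> V \<and> smooth_vector_field M V (apply_relation R X)"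
      by (intro exI[of _ W]) simp
  qed
  then show ?thesis
    by (simp add: vector_fields_def apply_relation_def)
qed

end

section \<open>Musical isomorphisms\<close>

locale riemannian_mfd = smooth_mfd n M
  for n :: nat and M :: "('m, 'e::real_inner) premanifold" +
  fixes g :: "'m \<Rightarrow> ('m, 'e) tvec \<Rightarrow> ('m, 'e) tvec \<Rightarrow> real"
  assumes metric: "riemannian_metric M g"
begin

lemma inner_product_at:
  assumes "p \<in> points M"
  shows "inner_product_subspace (tangent_space M p) (g p)"
proof
  show "inner_product_on (tangent_space M p) (g p)"
    using metric assms by (simp add: riemannian_metric_def inner_product_on_def)
qed (rule subspace_tangent_space)

lemma smooth_metric:
  "c \<in> atlas M \<Longrightarrow> smooth_on (\<lambda>x. g (chart_inv c x) (coord_vec M c e (chart_inv c x))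
    (coord_vec M c e' (chart_inv c x))) (snd c ` fst c)"
  using metric by (simp add: riemannian_metric_def)

text \<open>\<open>flat\<close> in a single fibre, needed because the Dirac structure is analysed
  point by point. The value \<open>0\<close> off the tangent space is the convention of
  \<open>cotangent_space\<close>.\<close>

definition lower :: "'m \<Rightarrow> ('m, 'e) tvec \<Rightarrow> ('m, 'e) covec" where
  "lower p x = (\<lambda>v. if v \<in> tangent_space M p then g p x v else 0)"

definition raise :: "'m \<Rightarrow> ('m, 'e) covec \<Rightarrow> ('m, 'e) tvec" where
  "raise p \<mu> = (THE z. z \<in> tangent_space M p \<and> (\<forall>v\<in>tangent_space M p. g p z v = \<mu> v))"

lemma flat_eq_lower: "flat M g X p = (if p \<in> points M then lower p (X p) else 0)"
  by (auto simp: flat_def lower_def fun_eq_iff)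

lemma subspace_cotangent_space: "subspace (cotangent_space M p)"
  by (rule subspaceI) (auto simp: cotangent_space_def linear_form_on_def algebra_simps)

lemma lower_mem:
  assumes "p \<in> points M" "x \<in> tangent_space M p"
  shows "lower p x \<in> cotangent_space M p"
proof -
  interpret inner_product_subspace "tangent_space M p" "g p"
    by (rule inner_product_at[OF assms(1)])
  show ?thesis
    using linear_right[OF assms(2)] subspace_add[OF subspace_T] subspace_scale[OF subspace_T]
    by (simp add: cotangent_space_def lower_def linear_form_on_def)
qed

lemma lower_inject:
  assumes "p \<in> points M" "x \<in> tangent_space M p" "y \<in> tangent_space M p" "lower p x = lower p y"
  shows "x = y"
proof -
  interpret inner_product_subspace "tangent_space M p" "g p"
    by (rule inner_product_at[OF assms(1)])
  show ?thesis
  proof (rule eqI[OF assms(2,3)])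
    show "g p x z = g p y z" if "z \<in> tangent_space M p" for z
      using fun_cong[OF assms(4), of z] that by (simp add: lower_def)
  qed
qed

lemma lower_sum:
  assumes "p \<in> points M" "\<And>i. i \<in> I \<Longrightarrow> x i \<in> tangent_space M p"
  shows "lower p (\<Sum>i\<in>I. c i *\<^sub>R x i) = (\<Sum>i\<in>I. c i *\<^sub>R lower p (x i))"
proof
  fix v
  interpret inner_product_subspace "tangent_space M p" "g p"
    by (rule inner_product_at[OF assms(1)])
  show "lower p (\<Sum>i\<in>I. c i *\<^sub>R x i) v = (\<Sum>i\<in>I. c i *\<^sub>R lower p (x i)) v"
    using sum_left[of v I x c] assms(2) by (simp add: lower_def sum_fun_apply)
qed

lemma lower_diff:
  assumes "p \<in> points M" "x \<in> tangent_space M p" "y \<in> tangent_space M p"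
  shows "lower p (x - y) = lower p x - lower p y"
proof
  fix v
  interpret inner_product_subspace "tangent_space M p" "g p"
    by (rule inner_product_at[OF assms(1)])
  show "lower p (x - y) v = (lower p x - lower p y) v"
    using assms by (simp add: lower_def diff_left)
qed

lemma raise_ex1:
  assumes p: "p \<in> points M" and \<mu>: "\<mu> \<in> cotangent_space M p"
  shows "\<exists>!z. z \<in> tangent_space M p \<and> (\<forall>v\<in>tangent_space M p. g p z v = \<mu> v)"
proof -
  interpret inner_product_subspace "tangent_space M p" "g p"
    by (rule inner_product_at[OF p])
  obtain c where c: "c \<in> charts_at M p"
    using chart_exists[OF p] .
  have "linear_form_on (tangent_space M p) \<mu>"
    using \<mu> by (simp add: cotangent_space_def)
  then obtain z where z: "z \<in> tangent_space M p" "\<forall>v\<in>tangent_space M p. g p z v = \<mu> v"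
    using riesz[OF model_basis(1) coord_vec_family(1)[OF c] coord_vec(1)[OF c] coord_vec_family(2)[OF c]]
    by blast
  show ?thesis
  proof (rule ex1I[of _ z])
    show "z' = z" if "z' \<in> tangent_space M p \<and> (\<forall>v\<in>tangent_space M p. g p z' v = \<mu> v)" for z'
      using that z by (intro eqI) auto
  qed (use z in blast)
qed

lemma raise:
  assumes "p \<in> points M" "\<mu> \<in> cotangent_space M p"
  shows "raise p \<mu> \<in> tangent_space M p"
    and "v \<in> tangent_space M p \<Longrightarrow> g p (raise p \<mu>) v = \<mu> v"
    and "lower p (raise p \<mu>) = \<mu>"
proof -
  have *: "raise p \<mu> \<in> tangent_space M p \<and> (\<forall>v\<in>tangent_space M p. g p (raise p \<mu>) v = \<mu> v)"
    unfolding raise_def by (rule theI'[OF raise_ex1[OF assms]])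
  then show "raise p \<mu> \<in> tangent_space M p"
    and "v \<in> tangent_space M p \<Longrightarrow> g p (raise p \<mu>) v = \<mu> v"
    by simp_all
  show "lower p (raise p \<mu>) = \<mu>"
    using * assms(2) by (auto simp: lower_def cotangent_space_def fun_eq_iff)
qed

text \<open>In the coordinate frame of a chart, the coefficients of the raised covector solve a
  system whose matrix is the Gram matrix of \<open>g\<close> and whose right-hand side is
  \<open>\<mu>\<close> on the frame. Both are smooth by the definitions of a metric and of a
  covector field.\<close>

lemma raise_smooth:
  assumes W: "openin (mtop M) W" and \<mu>: "smooth_covector_field M W \<mu>"
  shows "smooth_vector_field M W (\<lambda>p. raise p (\<mu> p))"
  unfolding smooth_vector_field_def
proof (intro conjI ballI)
  have W_sub: "W \<subseteq> points M"
    using W by (rule openin_subset)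
  have cot: "\<mu> q \<in> cotangent_space M q" if "q \<in> W" for q
    using \<mu> that by (simp add: smooth_covector_field_def)
  show "raise p (\<mu> p) \<in> tangent_space M p" if "p \<in> W" for p
    using raise(1) cot[OF that] W_sub that by blast
  fix c
  assume c: "c \<in> atlas M"
  let ?S = "snd c ` (fst c \<inter> W)"
  let ?E = "\<lambda>b x. coord_vec M c b (chart_inv c x)"
  have S: "open ?S"
    by (rule open_chart_image[OF c W])
  have at: "c \<in> charts_at M (chart_inv c x)" "chart_inv c x \<in> W" "chart_inv c x \<in> points M"
    if "x \<in> ?S" for x
    using chart_image_point[OF c that] W_sub by auto
  have "\<exists>a. (\<forall>b\<in>model_basis. smooth_on (a b) ?S) \<and>
      (\<forall>x\<in>?S. \<forall>b\<in>model_basis. (\<Sum>b'\<in>model_basis. g (chart_inv c x) (?E b x) (?E b' x) * a b' x)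
        = \<mu> (chart_inv c x) (?E b x))"
  proof (rule smooth_solution_positive_definite[OF S model_basis(1)])
    show "smooth_on (\<lambda>x. g (chart_inv c x) (?E b x) (?E b' x)) ?S" for b b'
      by (rule smooth_on_subset[OF smooth_metric[OF c]]) blast
    show "smooth_on (\<lambda>x. \<mu> (chart_inv c x) (?E b x)) ?S" for b
      using \<mu> c by (simp add: smooth_covector_field_def)
    fix x y
    assume x: "x \<in> ?S" and y: "\<exists>b\<in>model_basis. (y b :: real) \<noteq> 0"
    interpret inner_product_subspace "tangent_space M (chart_inv c x)" "g (chart_inv c x)"
      by (rule inner_product_at[OF at(3)[OF x]])
    show "0 < (\<Sum>b\<in>model_basis. \<Sum>b'\<in>model_basis. y b * y b' * g (chart_inv c x) (?E b x) (?E b' x))"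
      by (rule gram_positive_definite[OF coord_vec_family(1)[OF at(1)[OF x]] coord_vec(1)[OF at(1)[OF x]] y])
  qed
  then obtain a where a: "\<And>b. b \<in> model_basis \<Longrightarrow> smooth_on (a b) ?S"
    "\<And>x b. x \<in> ?S \<Longrightarrow> b \<in> model_basis \<Longrightarrow>
      (\<Sum>b'\<in>model_basis. g (chart_inv c x) (?E b x) (?E b' x) * a b' x) = \<mu> (chart_inv c x) (?E b x)"
    by auto
  \<comment> \<open>The frame vector of index \<open>b\<close> has the constant coordinate vector
    \<open>b\<close> in the chart \<open>c\<close>.\<close>
  have "(\<Sum>b\<in>model_basis. a b x *\<^sub>R b) = raise (chart_inv c x) (\<mu> (chart_inv c x)) c" if x: "x \<in> ?S" for x
  proof -
    let ?q = "chart_inv c x"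
    interpret inner_product_subspace "tangent_space M ?q" "g ?q"
      by (rule inner_product_at[OF at(3)[OF x]])
    note E = coord_vec(1)[OF at(1)[OF x]]
    define z where "z = (\<Sum>b\<in>model_basis. a b x *\<^sub>R ?E b x)"
    have z: "z \<in> tangent_space M ?q"
      unfolding z_def by (rule subspace_linear_combination[OF subspace_T E])
    have "g ?q z (?E b x) = \<mu> ?q (?E b x)" if b: "b \<in> model_basis" for b
    proof -
      have "g ?q z (?E b x) = g ?q (?E b x) z"
        using z E by (rule sym)
      also have "\<dots> = (\<Sum>b'\<in>model_basis. a b' x * g ?q (?E b x) (?E b' x))"
        unfolding z_def by (rule sum_right[OF E E])
      finally show ?thesis
        using a(2)[OF x b] by (simp add: mult.commute)
    qed
    moreover have "linear_form_on (tangent_space M ?q) (\<mu> ?q)"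
      using cot[OF at(2)[OF x]] by (simp add: cotangent_space_def)
    ultimately have "g ?q z v = \<mu> ?q v" if "v \<in> tangent_space M ?q" for v
      using linear_form_on_eqI[OF subspace_T linear_right[OF z] _ model_basis(1), of "\<mu> ?q" "\<lambda>b. ?E b x" v]
        E coord_vec_family(2)[OF at(1)[OF x]] that by blast
    then have "raise ?q (\<mu> ?q) = z"
      using z raise[OF at(3)[OF x] cot[OF at(2)[OF x]]] by (intro eqI) simp_all
    then show ?thesis
      by (simp add: z_def sum_fun_apply coord_vec(2)[OF at(1)[OF x]])
  qed
  moreover have "smooth_on (\<lambda>x. \<Sum>b\<in>model_basis. a b x *\<^sub>R b) ?S"
    by (intro smooth_on_sum[OF S] smooth_on_scaleR[OF S] a(1) smooth_on_const[OF S])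
  ultimately show "smooth_on (\<lambda>x. raise (chart_inv c x) (\<mu> (chart_inv c x)) c) ?S"
    by (rule smooth_on_cong[OF S])
qed

lemma flat_smooth:
  assumes X: "X \<in> vector_fields M"
  shows "flat M g X \<in> covector_fields M"
proof -
  have X': "smooth_vector_field M (points M) X"
    using X by (simp add: vector_fields_def)
  have "smooth_covector_field M (points M) (flat M g X)"
    unfolding smooth_covector_field_def
  proof (intro conjI ballI allI)
    show "flat M g X p \<in> cotangent_space M p" if "p \<in> points M" for p
      using lower_mem[OF that smooth_vector_fieldD(1)[OF X' that]] that by (simp add: flat_eq_lower)
    fix c e
    assume c: "c \<in> atlas M"
    let ?S = "snd c ` (fst c \<inter> points M)"
    let ?E = "\<lambda>b x. coord_vec M c b (chart_inv c x)"
    have S: "open ?S"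
      by (rule open_chart_image[OF c openin_topspace])
    note at = chart_image_point[OF c]
    \<comment> \<open>The constant basis of the model space is a smooth frame, so the coordinate
      functions of \<open>X\<close> are an instance of \<open>smooth_coefficients\<close>.\<close>
    have "\<exists>a. (\<forall>b\<in>model_basis. smooth_on (a b) ?S) \<and>
        (\<forall>x\<in>?S. X (chart_inv c x) c = (\<Sum>b\<in>model_basis. a b x *\<^sub>R b))"
      by (rule smooth_coefficients[OF S model_basis(1)])
        (simp_all add: smooth_on_const[OF S] smooth_vector_fieldD(2)[OF X' c] indep_model_basis model_basis)
    then obtain a where a: "\<And>b. b \<in> model_basis \<Longrightarrow> smooth_on (a b) ?S"
      "\<And>x. x \<in> ?S \<Longrightarrow> X (chart_inv c x) c = (\<Sum>b\<in>model_basis. a b x *\<^sub>R b)"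
      by auto
    have "(\<Sum>b\<in>model_basis. a b x * g (chart_inv c x) (?E b x) (?E e x))
        = flat M g X (chart_inv c x) (?E e x)" if x: "x \<in> ?S" for x
    proof -
      let ?q = "chart_inv c x"
      interpret inner_product_subspace "tangent_space M ?q" "g ?q"
        by (rule inner_product_at[OF at(2)[OF x]])
      note E = coord_vec[OF at(1)[OF x]]
      have "X ?q = (\<Sum>b\<in>model_basis. a b x *\<^sub>R ?E b x)"
        by (rule tangent_eq_sum[OF at(1)[OF x] smooth_vector_fieldD(1)[OF X' at(2)[OF x]]])
          (simp_all add: E a(2)[OF x])
      then show ?thesis
        using at(2)[OF x] E sum_left[of "?E e x" model_basis "\<lambda>b. ?E b x" "\<lambda>b. a b x"]
        by (simp add: flat_def)
    qed
    moreover have "smooth_on (\<lambda>x. \<Sum>b\<in>model_basis. a b x * g (chart_inv c x) (?E b x) (?E e x)) ?S"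
      by (intro smooth_on_sum[OF S] smooth_on_mult[OF S] a(1) smooth_on_subset[OF smooth_metric[OF c]]) auto
    ultimately show "smooth_on (\<lambda>x. flat M g X (chart_inv c x) (?E e x)) ?S"
      by (rule smooth_on_cong[OF S])
  qed
  then show ?thesis
    by (simp add: covector_fields_def flat_eq_lower)
qed

text \<open>Gives meaning to the inverse of \<open>flat\<close> by which
  \<open>covector_action\<close> is defined.\<close>

lemma inj_on_flat: "inj_on (flat M g) (vector_fields M)"
proof (rule inj_onI, rule ext)
  fix X Y p
  assume X: "X \<in> vector_fields M" and Y: "Y \<in> vector_fields M" and eq: "flat M g X = flat M g Y"
  show "X p = Y p"
  proof (cases "p \<in> points M")
    case True
    with X Y fun_cong[OF eq, of p] show ?thesis
      by (intro lower_inject[OF True]) (simp_all add: flat_eq_lower vector_fields_def smooth_vector_field_def)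
  next
    case False
    with X Y show ?thesis
      by (simp add: vector_fields_def)
  qed
qed

section \<open>The vector space of global vector fields\<close>

lemma vector_fields_add:
  assumes "X \<in> vector_fields M" "Y \<in> vector_fields M"
  shows "X + Y \<in> vector_fields M"
proof -
  have "(\<lambda>p. X p + Y p) = X + Y"
    by (rule ext) simp
  with assms smooth_vector_field_add[OF openin_topspace, of X Y] show ?thesis
    by (simp add: vector_fields_def)
qed

lemma vector_fields_scale:
  assumes "X \<in> vector_fields M"
  shows "a *\<^sub>R X \<in> vector_fields M"
proof -
  have "(\<lambda>p. a *\<^sub>R X p) = a *\<^sub>R X"
    by (rule ext) simp
  with assms smooth_vector_field_scale[OF openin_topspace, of X a] show ?thesis
    by (simp add: vector_fields_def)
qed

lemma vector_fields_diff: "X \<in> vector_fields M \<Longrightarrow> Y \<in> vector_fields M \<Longrightarrow> X - Y \<in> vector_fields M"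
  using vector_fields_add[of X "(- 1) *\<^sub>R Y"] vector_fields_scale[of Y "- 1"] by simp

lemma flat_diff:
  assumes "X \<in> vector_fields M" "Y \<in> vector_fields M"
  shows "flat M g X - flat M g Y = flat M g (X - Y)"
proof
  fix p
  show "(flat M g X - flat M g Y) p = flat M g (X - Y) p"
    using assms lower_diff[of p "X p" "Y p"]
    by (auto simp: flat_eq_lower vector_fields_def smooth_vector_field_def)
qed

text \<open>The fibre of \<open>TM \<oplus> T\<^sup>*M\<close> splits into the eigenspaces of the metric involution, on which the
  pairing is positive and negative definite; \<open>a\<close> and \<open>b\<close> are the components.\<close>

definition split_pair :: "'m \<Rightarrow> ('m, 'e) tvec \<Rightarrow> ('m, 'e) tvec \<Rightarrow> ('m, 'e) tvec \<times> ('m, 'e) covec" where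
  "split_pair p a b = (a + b, lower p (a - b))"

lemma split_pair_mem:
  "p \<in> points M \<Longrightarrow> a \<in> tangent_space M p \<Longrightarrow> b \<in> tangent_space M p \<Longrightarrow>
    split_pair p a b \<in> tangent_space M p \<times> cotangent_space M p"
  by (simp add: split_pair_def lower_mem subspace_add[OF subspace_tangent_space]
      subspace_diff[OF subspace_tangent_space])

text \<open>The mixed products of an \<open>a\<close> with a \<open>b\<close> cancel by symmetry of
  \<open>g\<close>; the others occur twice, which the factor 1/2 in \<open>pairing\<close>
  compensates.\<close>

lemma pairing_split_pair:
  assumes p: "p \<in> points M" and T: "a \<in> tangent_space M p" "b \<in> tangent_space M p"
    "a' \<in> tangent_space M p" "b' \<in> tangent_space M p"
  shows "pairing (split_pair p a b) (split_pair p a' b') = g p a a' - g p b b'"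
proof -
  interpret inner_product_subspace "tangent_space M p" "g p"
    by (rule inner_product_at[OF p])
  note add = subspace_add[OF subspace_T] and diff = subspace_diff[OF subspace_T]
  have "g p (a' - b') (a + b) + g p (a - b) (a' + b')
      = (g p a' a - g p b' a + (g p a' b - g p b' b)) + (g p a a' - g p b a' + (g p a b' - g p b b'))"
    using T by (simp add: add_right diff_left diff)
  also have "\<dots> = 2 * (g p a a' - g p b b')"
    using T sym[of a' a] sym[of b' a] sym[of a' b] sym[of b' b] by simp
  finally show ?thesis
    using T by (simp add: pairing_def split_pair_def lower_def add)
qed

lemma split_pair_sum:
  assumes p: "p \<in> points M" and "\<And>i. i \<in> I \<Longrightarrow> a i \<in> tangent_space M p"
    "\<And>i. i \<in> I \<Longrightarrow> b i \<in> tangent_space M p"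
  shows "split_pair p (\<Sum>i\<in>I. c i *\<^sub>R a i) (\<Sum>i\<in>I. c i *\<^sub>R b i)
    = (\<Sum>i\<in>I. c i *\<^sub>R split_pair p (a i) (b i))"
proof -
  have "lower p (\<Sum>i\<in>I. c i *\<^sub>R (a i - b i)) = (\<Sum>i\<in>I. c i *\<^sub>R lower p (a i - b i))"
    by (rule lower_sum[OF p]) (simp add: assms subspace_diff[OF subspace_tangent_space])
  then show ?thesis
    by (simp add: split_pair_def prod_eq_iff fst_sum snd_sum scaleR_add_right scaleR_diff_right
        sum.distrib sum_subtractf)
qed

lemma split_pair_add:
  assumes "p \<in> points M" "a \<in> tangent_space M p" "b \<in> tangent_space M p"
    "a' \<in> tangent_space M p" "b' \<in> tangent_space M p"
  shows "split_pair p (a + a') (b + b') = split_pair p a b + split_pair p a' b'"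
  \<comment> \<open>The two-term case of \<open>split_pair_sum\<close>, with the index set
    \<open>bool\<close> and all coefficients \<open>1\<close>.\<close>
  using split_pair_sum[OF assms(1), of "UNIV :: bool set" "\<lambda>i. if i then a else a'"
      "\<lambda>i. if i then b else b'" "\<lambda>_. 1"] assms
  by (simp add: UNIV_bool add.commute)

lemma split_pair_scale:
  assumes "p \<in> points M" "a \<in> tangent_space M p" "b \<in> tangent_space M p"
  shows "split_pair p (r *\<^sub>R a) (r *\<^sub>R b) = r *\<^sub>R split_pair p a b"
  using split_pair_sum[OF assms(1), of "UNIV :: unit set" "\<lambda>_. a" "\<lambda>_. b" "\<lambda>_. r"] assms
  by (simp add: UNIV_unit)

lemma split_pair_inject:
  assumes p: "p \<in> points M" and T: "a \<in> tangent_space M p" "b \<in> tangent_space M p"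
    "a' \<in> tangent_space M p" "b' \<in> tangent_space M p"
    and eq: "split_pair p a b = split_pair p a' b'"
  shows "a = a'" "b = b'"
proof -
  have "a + b = a' + b'" "lower p (a - b) = lower p (a' - b')"
    using eq by (simp_all add: split_pair_def)
  moreover from this(2) have "a - b = a' - b'"
    by (intro lower_inject[OF p]) (simp_all add: T subspace_diff[OF subspace_tangent_space])
  ultimately have "(a + b) + (a - b) = (a' + b') + (a' - b')" "(a + b) - (a - b) = (a' + b') - (a' - b')"
    by simp_all
  then have "2 *\<^sub>R a = 2 *\<^sub>R a'" "2 *\<^sub>R b = 2 *\<^sub>R b'"
    by (simp_all add: scaleR_2 algebra_simps)
  then show "a = a'" "b = b'"
    by simp_all
qed

text \<open>Half the sum and half the difference of \<open>Y\<close> and the raised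
  \<open>\<mu>\<close> invert the splitting. The difference is written with the factor
  \<open>- 1\<close> so that its smoothness follows from closure under addition and scaling.\<close>

lemma split_pair_decompose:
  assumes "p \<in> points M" "Y \<in> tangent_space M p" "\<mu> \<in> cotangent_space M p"
  shows "split_pair p ((1/2) *\<^sub>R (Y + raise p \<mu>)) ((1/2) *\<^sub>R (Y + (- 1) *\<^sub>R raise p \<mu>)) = (Y, \<mu>)"
proof -
  have half: "(1/2) *\<^sub>R x + (1/2) *\<^sub>R x = x" for x :: "('m, 'e) tvec"
    by (simp flip: scaleR_add_left)
  have "(1/2) *\<^sub>R (Y + z) + (1/2) *\<^sub>R (Y + (- 1) *\<^sub>R z) = Y"
    "(1/2) *\<^sub>R (Y + z) - (1/2) *\<^sub>R (Y + (- 1) *\<^sub>R z) = z" for z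
    using half[of Y] half[of z] by (simp_all add: scaleR_add_right algebra_simps)
  then show ?thesis
    by (simp only: split_pair_def raise(3)[OF assms(1,3)])
qed

end

section \<open>Dirac structures as orthogonal automorphisms\<close>

text \<open>Removes the inverse of \<open>flat\<close> hidden in \<open>L_of\<close>: by injectivity
  the action sends \<open>flat M g X\<close> to \<open>flat M g (B X)\<close>.\<close>

lemma sections_eq_L_ofI:
  assumes inj: "inj_on (flat M g) (vector_fields M)"
    and B: "\<And>X. X \<in> vector_fields M \<Longrightarrow> B X \<in> vector_fields M"
    and into: "\<And>X. X \<in> vector_fields M \<Longrightarrow> (X + B X, flat M g X - flat M g (B X)) \<in> sections M L"
    and onto: "\<And>Y \<mu>. (Y, \<mu>) \<in> sections M L \<Longrightarrow>
      \<exists>X\<in>vector_fields M. Y = X + B X \<and> \<mu> = flat M g X - flat M g (B X)"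
  shows "sections M L = L_of M g B"
proof -
  have act: "covector_action M g B (flat M g X) = flat M g (B X)" if "X \<in> vector_fields M" for X
    by (simp add: covector_action_def the_inv_into_f_f[OF inj that])
  have "L_of M g B = (\<lambda>X. (X + B X, flat M g X - flat M g (B X))) ` vector_fields M"
    unfolding L_of_def by (auto simp: act)
  moreover have "sections M L = (\<lambda>X. (X + B X, flat M g X - flat M g (B X))) ` vector_fields M"
  proof (intro equalityI subsetI)
    fix z
    assume z: "z \<in> sections M L"
    obtain Y \<mu> where z_eq: "z = (Y, \<mu>)"
      by fastforce
    obtain X where "X \<in> vector_fields M" "Y = X + B X" "\<mu> = flat M g X - flat M g (B X)"
      using onto[OF z[unfolded z_eq]] by (elim bexE conjE)
    then show "z \<in> (\<lambda>X. (X + B X, flat M g X - flat M g (B X))) ` vector_fields M"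
      unfolding z_eq by blast
  next
    fix z
    assume "z \<in> (\<lambda>X. (X + B X, flat M g X - flat M g (B X))) ` vector_fields M"
    then show "z \<in> sections M L"
      using into by (elim imageE) simp
  qed
  ultimately show ?thesis
    by simp
qed

locale dirac_mfd = riemannian_mfd n M g
  for n :: nat and M :: "('m, 'e::real_inner) premanifold" and g +
  fixes L :: "'m \<Rightarrow> (('m, 'e) tvec \<times> ('m, 'e) covec) set"
  assumes dirac: "dirac_structure M L"
begin

section \<open>Isotropy and maximality of the fibres\<close>

lemma fibre:
  assumes "p \<in> points M"
  shows "subspace (L p)" "L p \<subseteq> tangent_space M p \<times> cotangent_space M p"
    "x \<in> L p \<Longrightarrow> y \<in> L p \<Longrightarrow> pairing x y = 0"
    "isotropic_subspace M p V \<Longrightarrow> L p \<subseteq> V \<Longrightarrow> V = L p"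
  using dirac assms by (simp_all add: dirac_structure_def maximal_isotropic_def isotropic_subspace_def)

text \<open>Covectors are linear only on the tangent space, whence the membership
  conditions.\<close>

lemma pairing_add_scale:
  assumes "x \<in> tangent_space M p \<times> cotangent_space M p" "y \<in> tangent_space M p \<times> cotangent_space M p"
    "z \<in> tangent_space M p \<times> cotangent_space M p"
  shows "pairing (y + r *\<^sub>R x) z = pairing y z + r * pairing x z"
proof -
  have z: "linear_form_on (tangent_space M p) (snd z)"
    using assms(3) by (auto simp: cotangent_space_def)
  have T: "fst x \<in> tangent_space M p" "fst y \<in> tangent_space M p"
    using assms by auto
  have "snd z (fst y + r *\<^sub>R fst x) = snd z (fst y) + r * snd z (fst x)"
    using z T subspace_scale[OF subspace_tangent_space T(1), of r] by (simp add: linear_form_on_def)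
  then show ?thesis
    by (simp add: pairing_def field_simps)
qed

lemma pairing_commute: "pairing x y = pairing y x"
  by (simp add: pairing_def)

text \<open>A null vector orthogonal to the fibre spans with it another isotropic subspace, which
  maximality identifies with the fibre. All later use of maximality passes through this one-vector
  extension.\<close>

lemma fibre_maximal:
  assumes p: "p \<in> points M" and x: "x \<in> tangent_space M p \<times> cotangent_space M p"
    and "pairing x x = 0" and perp: "\<And>y. y \<in> L p \<Longrightarrow> pairing x y = 0"
  shows "x \<in> L p"
proof -
  let ?V = "span (insert x (L p))"
  have TT: "subspace (tangent_space M p \<times> cotangent_space M p)"
    by (intro subspace_Times subspace_tangent_space subspace_cotangent_space)
  have "isotropic_subspace M p ?V"
    unfolding isotropic_subspace_def
  proof (intro conjI ballI)
    show "subspace ?V"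
      by (rule subspace_span)
    show "?V \<subseteq> tangent_space M p \<times> cotangent_space M p"
      by (rule span_minimal) (use x fibre(2)[OF p] TT in auto)
    have V: "\<exists>y\<in>L p. \<exists>r. z = y + r *\<^sub>R x" if z: "z \<in> ?V" for z
    proof -
      obtain r where "z - r *\<^sub>R x \<in> span (L p)"
        using z unfolding span_insert by auto
      then have "z - r *\<^sub>R x \<in> L p"
        using fibre(1)[OF p] by (simp add: span_eq_iff[THEN iffD2])
      then show ?thesis
        by (intro bexI[of _ "z - r *\<^sub>R x"] exI[of _ r]) simp_all
    qed
    fix z z'
    assume "z \<in> ?V" "z' \<in> ?V"
    from V[OF this(1)] V[OF this(2)]
    obtain y r y' r' where y: "y \<in> L p" "y' \<in> L p" and z: "z = y + r *\<^sub>R x" "z' = y' + r' *\<^sub>R x"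
      by (elim bexE exE)
    have mem: "y \<in> tangent_space M p \<times> cotangent_space M p" "y' \<in> tangent_space M p \<times> cotangent_space M p"
      using y fibre(2)[OF p] by auto
    have right: "pairing w (y' + r' *\<^sub>R x) = pairing w y' + r' * pairing w x"
      if "w \<in> tangent_space M p \<times> cotangent_space M p" for w
      using pairing_add_scale[OF x mem(2) that, of r'] pairing_commute by metis
    have "y' + r' *\<^sub>R x \<in> tangent_space M p \<times> cotangent_space M p"
      using subspace_add[OF TT mem(2) subspace_scale[OF TT x, of r']] .
    then have "pairing z z' = pairing y y' + r' * pairing y x + r * (pairing x y' + r' * pairing x x)"
      unfolding z by (simp only: pairing_add_scale[OF x mem(1)] right mem x)
    also have "\<dots> = 0"
      using fibre(3)[OF p y] perp[OF y(1)] perp[OF y(2)] assms(3) pairing_commute[of y x] by simp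
    finally show "pairing z z' = 0" .
  qed
  then have "?V = L p"
    by (rule fibre(4)[OF p]) (use span_superset in blast)
  then show ?thesis
    using span_base[of x "insert x (L p)"] by simp
qed

text \<open>The fibre in the coordinates \<open>(a, b)\<close>. Since
  \<open>split_pair p x y\<close> has the shape of an element of \<open>L_B\<close> with
  \<open>y\<close> in place of \<open>B x\<close>, this is the graph that the required
  \<open>B\<close> must have at \<open>p\<close>.\<close>

definition rel :: "'m \<Rightarrow> ('m, 'e) tvec \<Rightarrow> ('m, 'e) tvec \<Rightarrow> bool" where
  "rel p a b \<longleftrightarrow> a \<in> tangent_space M p \<and> b \<in> tangent_space M p \<and> split_pair p a b \<in> L p"

lemma rel_isometry:
  assumes "p \<in> points M" "rel p a b" "rel p a' b'"
  shows "g p a a' = g p b b'"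
  using pairing_split_pair[OF assms(1), of a b a' b'] fibre(3)[OF assms(1), of "split_pair p a b" "split_pair p a' b'"]
    assms(2,3)
  by (simp add: rel_def)

lemma rel_add:
  assumes "p \<in> points M" "rel p a b" "rel p a' b'"
  shows "rel p (a + a') (b + b')"
  using assms fibre(1)[OF assms(1)]
  by (simp add: rel_def split_pair_add subspace_add subspace_tangent_space)

lemma rel_scale:
  assumes "p \<in> points M" "rel p a b"
  shows "rel p (r *\<^sub>R a) (r *\<^sub>R b)"
  using assms fibre(1)[OF assms(1)]
  by (simp add: rel_def split_pair_scale subspace_scale subspace_tangent_space)

text \<open>Both families are the components of one local frame of \<open>L\<close>. Its
  independence alone does not make either family independent; that needs the isometry property, and
  spanning needs maximality. Both arguments are symmetric in \<open>u\<close> and \<open>w\<close>,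
  which gives the converse relation as well.\<close>

lemma rel_local_frame:
  assumes p: "p \<in> points M"
  shows "\<exists>W k u w. openin (mtop M) W \<and> p \<in> W \<and> graph_frame rel W k u w \<and>
    graph_frame (\<lambda>q a b. rel q b a) W k w u"
proof -
  obtain k W and s :: "nat \<Rightarrow> 'm \<Rightarrow> ('m, 'e) tvec \<times> ('m, 'e) covec" where
    W: "openin (mtop M) W" "p \<in> W"
    and s: "\<forall>i<k. smooth_vector_field M W (\<lambda>q. fst (s i q)) \<and> smooth_covector_field M W (\<lambda>q. snd (s i q))"
    and frame: "\<forall>q\<in>W. inj_on (\<lambda>i. s i q) {..<k} \<and> independent ((\<lambda>i. s i q) ` {..<k}) \<and>
      span ((\<lambda>i. s i q) ` {..<k}) = L q"
    by (rule exE[OF dirac[unfolded dirac_structure_def smooth_subbundle_def, THEN conjunct1]],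
        drule bspec[OF _ p], elim exE conjE, rule that; assumption)
  have W_sub: "W \<subseteq> points M"
    using W(1) by (rule openin_subset)
  \<comment> \<open>The components of \<open>s i q\<close> given by
    \<open>split_pair_decompose\<close>.\<close>
  define u where "u i q = (1/2) *\<^sub>R (fst (s i q) + raise q (snd (s i q)))" for i q
  define w where "w i q = (1/2) *\<^sub>R (fst (s i q) + (- 1) *\<^sub>R raise q (snd (s i q)))" for i q
  have smooth: "smooth_vector_field M W (u i)" "smooth_vector_field M W (w i)" if "i < k" for i
    unfolding u_def[abs_def] w_def[abs_def] using s that
    by (intro smooth_vector_field_scale[OF W(1)] smooth_vector_field_add[OF W(1)] raise_smooth[OF W(1)]; simp)+
  have core: "indep_family {..<k} (\<lambda>i. u i q) \<and> indep_family {..<k} (\<lambda>i. w i q) \<and>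
      tangent_space M q \<subseteq> span ((\<lambda>i. u i q) ` {..<k}) \<and> tangent_space M q \<subseteq> span ((\<lambda>i. w i q) ` {..<k}) \<and>
      (\<forall>a b. rel q a b \<longleftrightarrow> (\<exists>c. a = (\<Sum>i\<in>{..<k}. c i *\<^sub>R u i q) \<and> b = (\<Sum>i\<in>{..<k}. c i *\<^sub>R w i q)))"
    if q: "q \<in> W" for q
  proof -
    have qM: "q \<in> points M"
      using q W_sub by blast
    interpret inner_product_subspace "tangent_space M q" "g q"
      by (rule inner_product_at[OF qM])
    have uT: "u i q \<in> tangent_space M q" and wT: "w i q \<in> tangent_space M q" if "i \<in> {..<k}" for i
      using smooth[of i] that q smooth_vector_fieldD(1) by auto
    let ?U = "\<lambda>c. \<Sum>i\<in>{..<k}. c i *\<^sub>R u i q" and ?W = "\<lambda>c. \<Sum>i\<in>{..<k}. c i *\<^sub>R w i q"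
      and ?s = "\<lambda>c. \<Sum>i\<in>{..<k}. c i *\<^sub>R s i q"
    have UT: "?U c \<in> tangent_space M q" and WT: "?W c \<in> tangent_space M q" for c
      by (rule subspace_linear_combination[OF subspace_T], fact uT,
          rule subspace_linear_combination[OF subspace_T], fact wT)
    have s_mem: "split_pair q (u i q) (w i q) = s i q" if "i \<in> {..<k}" for i
    proof -
      have "fst (s i q) \<in> tangent_space M q" "snd (s i q) \<in> cotangent_space M q"
        using s q that by (auto simp: smooth_vector_field_def smooth_covector_field_def)
      from split_pair_decompose[OF qM this] show ?thesis
        by (simp add: u_def w_def)
    qed
    have sum_s: "split_pair q (?U c) (?W c) = ?s c" for c
      using split_pair_sum[OF qM, of "{..<k}" "\<lambda>i. u i q" "\<lambda>i. w i q" c] uT wT s_mem by simp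
    have L: "x \<in> L q \<longleftrightarrow> (\<exists>c. x = ?s c)" for x
      using span_family_iff[of "{..<k}" x "\<lambda>i. s i q"] frame q by simp
    have rel_U: "rel q (?U c) (?W c)" for c
    proof -
      have "?s c \<in> L q"
        unfolding L by (intro exI[of _ c] refl)
      then show ?thesis
        using UT WT by (simp add: rel_def sum_s)
    qed
    have rel_iff: "rel q a b \<longleftrightarrow> (\<exists>c. a = ?U c \<and> b = ?W c)" for a b
    proof
      assume ab: "rel q a b"
      then obtain c where "split_pair q a b = ?s c"
        unfolding rel_def L by (elim conjE exE)
      then have "split_pair q a b = split_pair q (?U c) (?W c)"
        by (simp only: sum_s)
      from split_pair_inject[OF qM _ _ UT WT this] ab show "\<exists>c. a = ?U c \<and> b = ?W c"
        by (intro exI[of _ c]) (simp add: rel_def)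
    next
      assume "\<exists>c. a = ?U c \<and> b = ?W c"
      then show "rel q a b"
        using rel_U by (elim exE conjE) simp
    qed
    \<comment> \<open>The two combinations have the same length, so each vanishes with the other;
      then the combination of the \<open>s i q\<close> vanishes too, and with it all
      coefficients.\<close>
    have zero_iff: "?U c = 0 \<longleftrightarrow> ?W c = 0" for c
    proof -
      have "?U c = 0 \<longleftrightarrow> g q (?U c) (?U c) = 0"
        by (rule eq_zero_iff[OF UT, symmetric])
      also have "\<dots> \<longleftrightarrow> g q (?W c) (?W c) = 0"
        by (simp only: rel_isometry[OF qM rel_U rel_U])
      also have "\<dots> \<longleftrightarrow> ?W c = 0"
        by (rule eq_zero_iff[OF WT])
      finally show ?thesis .
    qed
    have s_indep: "indep_family {..<k} (\<lambda>i. s i q)"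
      using frame q by (simp add: indep_family_iff)
    have coeff_zero: "c i = 0" if "?U c = 0" "?W c = 0" "i \<in> {..<k}" for c i
    proof -
      have "?s c = split_pair q 0 0"
        using sum_s[of c] that by simp
      also have "\<dots> = 0"
        using split_pair_scale[OF qM subspace_0[OF subspace_T] subspace_0[OF subspace_T], of 0] by simp
      finally show ?thesis
        using that(3) by (rule indep_familyD[OF s_indep])
    qed
    have ind_u: "indep_family {..<k} (\<lambda>i. u i q)"
      unfolding indep_family_def
    proof (intro allI impI ballI)
      show "c i = 0" if "?U c = 0" "i \<in> {..<k}" for c i
        by (rule coeff_zero[OF that(1) iffD1[OF zero_iff that(1)] that(2)])
    qed
    have ind_w: "indep_family {..<k} (\<lambda>i. w i q)"
      unfolding indep_family_def
    proof (intro allI impI ballI)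
      show "c i = 0" if "?W c = 0" "i \<in> {..<k}" for c i
        by (rule coeff_zero[OF iffD2[OF zero_iff that(1)] that])
    qed
    have rel_i: "rel q (u i q) (w i q)" if "i \<in> {..<k}" for i
    proof -
      have "s i q \<in> L q"
        using span_base[of "s i q" "(\<lambda>i. s i q) ` {..<k}"] frame q that by auto
      then show ?thesis
        using uT[OF that] wT[OF that] s_mem[OF that] by (simp add: rel_def)
    qed
    have iso: "g q (u i q) (u j q) = g q (w i q) (w j q)" if "i \<in> {..<k}" "j \<in> {..<k}" for i j
      by (rule rel_isometry[OF qM rel_i[OF that(1)] rel_i[OF that(2)]])
    \<comment> \<open>Equal lengths make the pair a null vector, and matching products make it
      orthogonal to the frame of \<open>L q\<close>, so maximality puts it into the fibre.\<close>
    have max: "rel q a b" if ab: "a \<in> tangent_space M q" "b \<in> tangent_space M q" "g q a a = g q b b"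
      and perp: "\<forall>i\<in>{..<k}. g q a (u i q) = g q b (w i q)" for a b
    proof -
      have "split_pair q a b \<in> L q"
      proof (rule fibre_maximal[OF qM split_pair_mem[OF qM ab(1,2)]])
        show "pairing (split_pair q a b) (split_pair q a b) = 0"
          using pairing_split_pair[OF qM ab(1,2) ab(1,2)] ab(3) by simp
        fix y
        assume "y \<in> L q"
        then obtain c where "y = ?s c"
          unfolding L by (rule exE)
        then have "pairing (split_pair q a b) y = g q a (?U c) - g q b (?W c)"
          by (simp only: pairing_split_pair[OF qM ab(1,2) UT WT] flip: sum_s)
        also have "\<dots> = 0"
          using sum_right[OF ab(1), of "{..<k}" "\<lambda>i. u i q" c] sum_right[OF ab(2), of "{..<k}" "\<lambda>i. w i q" c]
            uT wT perp by simp
        finally show "pairing (split_pair q a b) y = 0" .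
      qed
      with ab show ?thesis
        by (simp add: rel_def)
    qed
    have span_u: "?U c \<in> span ((\<lambda>i. u i q) ` {..<k})" and span_w: "?W c \<in> span ((\<lambda>i. w i q) ` {..<k})" for c
      unfolding span_family_iff[OF finite_lessThan] by (rule exI[of _ c], rule refl)+
    have "tangent_space M q \<subseteq> span ((\<lambda>i. u i q) ` {..<k})"
    proof (rule maximal_partial_isometry_total[OF finite_lessThan uT wT iso ind_u])
      fix a b
      assume "a \<in> tangent_space M q" "b \<in> tangent_space M q" "g q a a = g q b b"
        "\<forall>i\<in>{..<k}. g q a (u i q) = g q b (w i q)"
      then have "rel q a b"
        by (rule max)
      then show "a \<in> span ((\<lambda>i. u i q) ` {..<k})"
        unfolding rel_iff by (elim exE conjE) (simp only: span_u)
    qed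
    \<comment> \<open>The conditions in \<open>max\<close> are symmetric, so it also excludes an
      extension with the two families exchanged.\<close>
    moreover have "tangent_space M q \<subseteq> span ((\<lambda>i. w i q) ` {..<k})"
    proof (rule maximal_partial_isometry_total[OF finite_lessThan wT uT iso[symmetric] ind_w])
      fix a b
      assume ab: "a \<in> tangent_space M q" "b \<in> tangent_space M q" "g q a a = g q b b"
        "\<forall>i\<in>{..<k}. g q a (w i q) = g q b (u i q)"
      have "rel q b a"
        by (rule max[OF ab(2,1)]) (use ab in simp_all)
      then show "a \<in> span ((\<lambda>i. w i q) ` {..<k})"
        unfolding rel_iff by (elim exE conjE) (simp only: span_w)
    qed
    ultimately show ?thesis
      using ind_u ind_w rel_iff by simp
  qed
  have "graph_frame rel W k u w"
    unfolding graph_frame_def using smooth core by simp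
  moreover have "graph_frame (\<lambda>q a b. rel q b a) W k w u"
    unfolding graph_frame_def using smooth core by (simp add: conj_commute)
  ultimately show ?thesis
    using W by blast
qed

lemma locally_graph_rel: "locally_graph rel" "locally_graph (\<lambda>q a b. rel q b a)"
  unfolding locally_graph_def using rel_local_frame by blast+

section \<open>The global automorphism\<close>

lemma vector_fieldD:
  "X \<in> vector_fields M \<Longrightarrow> p \<in> points M \<Longrightarrow> X p \<in> tangent_space M p"
  "X \<in> vector_fields M \<Longrightarrow> p \<notin> points M \<Longrightarrow> X p = 0"
  by (simp_all add: vector_fields_def smooth_vector_field_def)

lemma exists_orthogonal_automorphism:
  "\<exists>B. module_automorphism M B \<and> orthogonal_map M g B \<and> sections M L = L_of M g B"
proof -
  define B where "B = apply_relation rel"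
  define B' where "B' = apply_relation (\<lambda>q a b. rel q b a)"
  have B: "B X \<in> vector_fields M" and B': "B' X \<in> vector_fields M" if "X \<in> vector_fields M" for X
    unfolding B_def B'_def
    by (rule apply_relation_smooth[OF locally_graph_rel(1) that],
        rule apply_relation_smooth[OF locally_graph_rel(2) that])
  have rel_B: "rel p (X p) b \<longleftrightarrow> b = B X p" and rel_B': "rel p b (X p) \<longleftrightarrow> b = B' X p"
    if "X \<in> vector_fields M" "p \<in> points M" for X p b
    unfolding B_def B'_def
    by (rule apply_relation_iff[where X = X, OF locally_graph_rel(1) that(2) vector_fieldD(1)[OF that]],
        rule apply_relation_iff[where X = X, OF locally_graph_rel(2) that(2) vector_fieldD(1)[OF that]])
  \<comment> \<open>\<open>rel p (X p) (B X p)\<close> also says that the converse relation assigns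
    \<open>X p\<close> to \<open>B X p\<close>; at non-points all fields are
    \<open>0\<close>.\<close>
  have B'B: "B' (B X) = X" and BB': "B (B' X) = X" if X: "X \<in> vector_fields M" for X
  proof -
    show "B' (B X) = X"
    proof (rule ext)
      show "B' (B X) p = X p" for p
        using rel_B[OF X, of p "B X p"] rel_B'[OF B[OF X], of p "X p"] vector_fieldD(2)[OF X] vector_fieldD(2)[OF B'[OF B[OF X]]]
        by (cases "p \<in> points M") auto
    qed
    show "B (B' X) = X"
    proof (rule ext)
      show "B (B' X) p = X p" for p
        using rel_B'[OF X, of p "B' X p"] rel_B[OF B'[OF X], of p "X p"] vector_fieldD(2)[OF X] vector_fieldD(2)[OF B[OF B'[OF X]]]
        by (cases "p \<in> points M") auto
    qed
  qed
  have rel_BX: "rel p (X p) (B X p)" if "X \<in> vector_fields M" "p \<in> points M" for X p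
    using rel_B[OF that] by simp
  have "bij_betw B (vector_fields M) (vector_fields M)"
    by (rule bij_betw_byWitness[of _ B']) (use B B' B'B BB' in auto)
  moreover have "B (X + Y) = B X + B Y" if X: "X \<in> vector_fields M" and Y: "Y \<in> vector_fields M" for X Y
  proof (rule ext)
    fix p
    show "B (X + Y) p = (B X + B Y) p"
    proof (cases "p \<in> points M")
      case True
      have "rel p ((X + Y) p) ((B X + B Y) p)"
        using rel_add[OF True rel_BX[OF X True] rel_BX[OF Y True]] by simp
      then show ?thesis
        using rel_B[OF vector_fields_add[OF X Y] True] by simp
    next
      case False
      then show ?thesis
        using vector_fieldD(2)[OF _ False] B vector_fields_add X Y by (simp add: zero_fun_def)
    qed
  qed
  moreover have "B (\<lambda>p. f p *\<^sub>R X p) = (\<lambda>p. f p *\<^sub>R B X p)" if X: "X \<in> vector_fields M" for f X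
  proof (rule ext)
    fix p
    show "B (\<lambda>p. f p *\<^sub>R X p) p = f p *\<^sub>R B X p"
    proof (cases "p \<in> points M")
      \<comment> \<open>\<open>rel_B\<close> would ask for a global field, whereas
        \<open>apply_relation_iff\<close> asks only for a tangent vector at \<open>p\<close>, so the
        claim is homogeneity of \<open>rel p\<close> with the number \<open>f p\<close>.\<close>
      case True
      have "f p *\<^sub>R X p \<in> tangent_space M p"
        using subspace_scale[OF subspace_tangent_space vector_fieldD(1)[OF X True]] .
      with rel_scale[OF True rel_BX[OF X True], of "f p"] show ?thesis
        using apply_relation_iff[OF locally_graph_rel(1) True, of "\<lambda>p. f p *\<^sub>R X p" "f p *\<^sub>R B X p"]
        by (simp add: B_def)
    next
      case False
      then show ?thesis
        by (simp add: B_def apply_relation_def)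
    qed
  qed
  ultimately have "module_automorphism M B"
    unfolding module_automorphism_def by simp
  moreover have "orthogonal_map M g B"
    unfolding orthogonal_map_def
    by (intro ballI rel_isometry[symmetric] rel_BX)
  moreover have "sections M L = L_of M g B"
  proof (rule sections_eq_L_ofI[OF inj_on_flat B])
    fix X
    assume X: "X \<in> vector_fields M"
    have flat_X: "flat M g X - flat M g (B X) = flat M g (X - B X)"
      by (rule flat_diff[OF X B[OF X]])
    have "(X + B X) p = X p + B X p" "flat M g (X - B X) p = lower p (X p - B X p)" if "p \<in> points M" for p
      using that by (simp_all add: flat_eq_lower)
    then have "((X + B X) p, flat M g (X - B X) p) \<in> L p" if "p \<in> points M" for p
      using rel_BX[OF X that] that unfolding rel_def split_pair_def by simp
    then show "(X + B X, flat M g X - flat M g (B X)) \<in> sections M L"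
      unfolding sections_def flat_X
      using vector_fields_add[OF X B[OF X]] flat_smooth[OF vector_fields_diff[OF X B[OF X]]] by simp
  next
    fix Y \<mu>
    assume "(Y, \<mu>) \<in> sections M L"
    then have Y: "Y \<in> vector_fields M" and \<mu>: "\<mu> \<in> covector_fields M"
      and mem: "\<And>p. p \<in> points M \<Longrightarrow> (Y p, \<mu> p) \<in> L p"
      by (simp_all add: sections_def)
    \<comment> \<open>The raised \<open>\<mu>\<close>, set to \<open>0\<close> at non-points to make
      it a global section.\<close>
    define Z where "Z p = (if p \<in> points M then raise p (\<mu> p) else 0)" for p
    have cot: "\<mu> p \<in> cotangent_space M p" if "p \<in> points M" for p
      using \<mu> that by (simp add: covector_fields_def smooth_covector_field_def)
    have "smooth_vector_field M (points M) (\<lambda>p. raise p (\<mu> p))"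
      using \<mu> by (intro raise_smooth openin_topspace) (simp add: covector_fields_def)
    then have "smooth_vector_field M (points M) Z"
    proof -
      assume sm: "smooth_vector_field M (points M) (\<lambda>p. raise p (\<mu> p))"
      show ?thesis
        unfolding smooth_vector_field_def
      proof (intro conjI ballI)
        show "Z p \<in> tangent_space M p" if "p \<in> points M" for p
          using smooth_vector_fieldD(1)[OF sm that] that by (simp add: Z_def)
        fix c
        assume c: "c \<in> atlas M"
        show "smooth_on (\<lambda>x. Z (chart_inv c x) c) (snd c ` (fst c \<inter> points M))"
          by (rule smooth_on_cong[OF open_chart_image[OF c openin_topspace] _ smooth_vector_fieldD(2)[OF sm c]])
            (simp add: Z_def chart_image_point(2)[OF c])
      qed
    qed
    then have Z: "Z \<in> vector_fields M"
      by (simp add: vector_fields_def Z_def)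
    \<comment> \<open>The component \<open>a\<close> of the section. The other component
      \<open>?b\<close> is related to it by membership in the fibre, so single-valuedness identifies
      \<open>?b\<close> with \<open>B X p\<close>.\<close>
    define X where "X = (1/2) *\<^sub>R (Y + Z)"
    have X: "X \<in> vector_fields M"
      unfolding X_def by (intro vector_fields_scale vector_fields_add Y Z)
    have sp: "split_pair p (X p) (B X p) = (Y p, \<mu> p)" if p: "p \<in> points M" for p
    proof -
      let ?b = "(1/2) *\<^sub>R (Y p + (- 1) *\<^sub>R Z p)"
      have Xp: "split_pair p (X p) ?b = (Y p, \<mu> p)"
        using split_pair_decompose[OF p vector_fieldD(1)[OF Y p] cot[OF p]] p by (simp add: X_def Z_def)
      have "?b \<in> tangent_space M p"
        by (intro subspace_scale subspace_add subspace_tangent_space vector_fieldD(1) Y Z p)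
      then have "rel p (X p) ?b"
        using mem[OF p] vector_fieldD(1)[OF X p] by (simp only: rel_def Xp simp_thms)
      with Xp show ?thesis
        using rel_B[OF X p] by simp
    qed
    have "Y = X + B X"
    proof (rule ext)
      show "Y p = (X + B X) p" for p
        using sp[of p] vector_fieldD(2)[OF Y] vector_fieldD(2)[OF X] vector_fieldD(2)[OF B[OF X]]
        by (cases "p \<in> points M") (simp_all add: split_pair_def)
    qed
    moreover have "\<mu> = flat M g X - flat M g (B X)"
      unfolding flat_diff[OF X B[OF X]]
    proof (rule ext)
      show "\<mu> p = flat M g (X - B X) p" for p
        using sp[of p] \<mu>
        by (cases "p \<in> points M") (simp_all add: split_pair_def flat_eq_lower covector_fields_def)
    qed
    ultimately show "\<exists>X\<in>vector_fields M. Y = X + B X \<and> \<mu> = flat M g X - flat M g (B X)"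
      using X by blast
  qed
  ultimately show ?thesis
    by blast
qed

end

theorem proposition3p9:
  fixes n :: nat
    and M :: "('m, 'e::real_inner) premanifold"
    and g :: "'m \<Rightarrow> ('m, 'e) tvec \<Rightarrow> ('m, 'e) tvec \<Rightarrow> real"
    and L :: "'m \<Rightarrow> (('m, 'e) tvec \<times> ('m, 'e) covec) set"
  assumes "smooth_manifold n M"
    and "riemannian_metric M g"
    and "dirac_structure M L"
  shows "\<exists>B. module_automorphism M B \<and> orthogonal_map M g B \<and> sections M L = L_of M g B"
proof -
  interpret dirac_mfd n M g L
    using assms by unfold_locales
  show ?thesis
    by (rule exists_orthogonal_automorphism)
qed

end
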